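(* Let $v$ be a vertex of tenacity $t<l_m$. Then the set $B=\{F(p,v) : p \text{ is an } \mathrm{evenlevel}(v)\text{ path or an }\mathrm{oddlevel}(v)\text{ path}\}$ is a singleton.
   Context: $G=(V,E)$ is a finite undirected graph with a matching $M$, and at least one vertex is not covered by $M$ (unmatched). An alternating path is a simple path whose edges alternate between edges not in $M$ (unmatched) and edges in $M$ (matched); an alternating path from an unmatched vertex starts with an unmatched edge. An augmenting path is an alternating path between two distinct unmatched vertices; $l_m$ is the minimum length of an augmenting path ($l_m=\infty$ if none exists). $\mathrm{evenlevel}(v)$ (resp. $\mathrm{oddlevel}(v)$) is the minimum length of an even (resp. odd) length alternating path from some unmatched vertex to $v$ ($\infty$ if none); an alternating path from an unmatched vertex to $v$ attaining this minimum is an $\mathrm{evenlevel}(v)$ (resp. $\mathrm{oddlevel}(v)$) path. The tenacity of a vertex is $t(v)=\mathrm{evenlevel}(v)+\mathrm{oddlevel}(v)$. For $v$ with $t(v)=t<l_m$ and $p$ an $\mathrm{evenlevel}(v)$ or $\mathrm{oddlevel}(v)$ path starting at unmatched vertex $f$, the base of $v$ w.r.t. $p$, $F(p,v)$, is the vertex of tenacity $>t$ on $p$ that is furthest from $f$ along $p$. *)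

theory Defs
  imports "HOL-Library.Extended_Nat" "HOL-Library.Disjoint_Sets"
begin

definition finite_graph :: "'a set \<Rightarrow> 'a set set \<Rightarrow> bool" where
  "finite_graph V E \<longleftrightarrow> finite V \<and> (\<forall>e\<in>E. e \<subseteq> V \<and> card e = 2)"

definition matching :: "'a set set \<Rightarrow> 'a set set \<Rightarrow> bool" where
  "matching E M \<longleftrightarrow> M \<subseteq> E \<and> disjoint M"

definition unmatched :: "'a set \<Rightarrow> 'a set set \<Rightarrow> 'a set" where
  "unmatched V M = V - \<Union>M"

text \<open>A path is the non-empty list of its vertices; its length is its number of edges.\<close>

definition simple_path :: "'a set \<Rightarrow> 'a set set \<Rightarrow> 'a list \<Rightarrow> bool" where
  "simple_path V E p \<longleftrightarrow> p \<noteq> [] \<and> set p \<subseteq> V \<and> distinct p \<and>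
     (\<forall>i. Suc i < length p \<longrightarrow> {p ! i, p ! Suc i} \<in> E)"

definition path_length :: "'a list \<Rightarrow> nat" where
  "path_length p = length p - 1"

text \<open>An edge at an unmatched vertex is never in \<open>M\<close>, so an alternating path from an unmatched
  vertex starts with an edge outside \<open>M\<close> without this being demanded separately.\<close>

definition alternating_path :: "'a set \<Rightarrow> 'a set set \<Rightarrow> 'a set set \<Rightarrow> 'a list \<Rightarrow> bool" where
  "alternating_path V E M p \<longleftrightarrow> simple_path V E p \<and>
     (\<forall>i. Suc (Suc i) < length p \<longrightarrow>
        ({p ! i, p ! Suc i} \<in> M \<longleftrightarrow> {p ! Suc i, p ! Suc (Suc i)} \<notin> M))"

definition augmenting_path :: "'a set \<Rightarrow> 'a set set \<Rightarrow> 'a set set \<Rightarrow> 'a list \<Rightarrow> bool" where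
  "augmenting_path V E M p \<longleftrightarrow> alternating_path V E M p \<and>
     hd p \<in> unmatched V M \<and> last p \<in> unmatched V M \<and> hd p \<noteq> last p"

text \<open>On \<open>enat\<close>, the infimum of the empty set is \<open>\<infinity>\<close>.\<close>

definition min_augmenting_length :: "'a set \<Rightarrow> 'a set set \<Rightarrow> 'a set set \<Rightarrow> enat" where
  "min_augmenting_length V E M = (INF p\<in>{p. augmenting_path V E M p}. enat (path_length p))"

definition alternating_paths_to :: "'a set \<Rightarrow> 'a set set \<Rightarrow> 'a set set \<Rightarrow> 'a \<Rightarrow> 'a list set" where
  "alternating_paths_to V E M v =
     {p. alternating_path V E M p \<and> hd p \<in> unmatched V M \<and> last p = v}"

definition evenlevel :: "'a set \<Rightarrow> 'a set set \<Rightarrow> 'a set set \<Rightarrow> 'a \<Rightarrow> enat" where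
  "evenlevel V E M v =
     (INF p\<in>{p \<in> alternating_paths_to V E M v. even (path_length p)}. enat (path_length p))"

definition oddlevel :: "'a set \<Rightarrow> 'a set set \<Rightarrow> 'a set set \<Rightarrow> 'a \<Rightarrow> enat" where
  "oddlevel V E M v =
     (INF p\<in>{p \<in> alternating_paths_to V E M v. odd (path_length p)}. enat (path_length p))"

definition evenlevel_path :: "'a set \<Rightarrow> 'a set set \<Rightarrow> 'a set set \<Rightarrow> 'a \<Rightarrow> 'a list \<Rightarrow> bool" where
  "evenlevel_path V E M v p \<longleftrightarrow> p \<in> alternating_paths_to V E M v \<and>
     even (path_length p) \<and> enat (path_length p) = evenlevel V E M v"

definition oddlevel_path :: "'a set \<Rightarrow> 'a set set \<Rightarrow> 'a set set \<Rightarrow> 'a \<Rightarrow> 'a list \<Rightarrow> bool" where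
  "oddlevel_path V E M v p \<longleftrightarrow> p \<in> alternating_paths_to V E M v \<and>
     odd (path_length p) \<and> enat (path_length p) = oddlevel V E M v"

definition tenacity :: "'a set \<Rightarrow> 'a set set \<Rightarrow> 'a set set \<Rightarrow> 'a \<Rightarrow> enat" where
  "tenacity V E M v = evenlevel V E M v + oddlevel V E M v"

text \<open>The set of indices is non-empty whenever \<open>v\<close> has tenacity less than the minimum length of an
  augmenting path: an odd alternating path between unmatched vertices is augmenting, so the
  unmatched vertex \<open>hd p\<close> has tenacity at least that minimum.\<close>

definition base_wrt :: "'a set \<Rightarrow> 'a set set \<Rightarrow> 'a set set \<Rightarrow> 'a list \<Rightarrow> 'a \<Rightarrow> 'a" where
  "base_wrt V E M p v = p ! Max {i. i < length p \<and> tenacity V E M (p ! i) > tenacity V E M v}"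

end

theory Submission imports Defs begin

text \<open>
  Write \<open>F \<tau> p\<close> for the last vertex of tenacity above \<open>\<tau>\<close> on a path \<open>p\<close>. By induction on the odd
  number \<open>\<tau>\<close> below the minimum augmenting length, \<open>F \<tau>\<close> takes the same value on all level paths of a
  vertex of tenacity at most \<open>\<tau>\<close>, and on the level paths to the two ends of an edge of tenacity at
  most \<open>\<tau>\<close>. Call this value the \<open>\<tau>\<close>-base of the vertex.

  The classes of equal \<open>\<sigma>\<close>-base, for odd \<open>\<sigma> < T\<close>, are the blossoms of Edmonds' algorithm, and together
  with vertex potentials read off from the levels they form a feasible dual solution of the matching
  problem. Weak duality bounds the length of every alternating path from below, and level paths
  attain the bound. By complementary slackness a level path visits every vertex of tenacity at least
  \<open>T\<close> at one of two complementary positions (their sum is \<open>T\<close>), and it passes through the vertices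
  of smaller tenacity in a blossom in one stretch next to the base.

  Let \<open>u v\<close> be an edge of tenacity exactly \<open>T\<close> with level paths \<open>p\<close>, \<open>q\<close> to its ends, \<open>p\<close> not longer
  than \<open>q\<close>. If \<open>q\<close> missed the part of \<open>p\<close> from \<open>b = F T p\<close> on, then \<open>q\<close> followed by \<open>v u\<close> and this
  part backwards would give \<open>b\<close> tenacity at most \<open>T\<close>. So they meet, hence they share a vertex \<open>n\<close> of
  tenacity at least \<open>T\<close> at the same position, and by induction on the length of \<open>p\<close> the last vertex
  of large tenacity on \<open>q\<close> up to \<open>n\<close> is \<open>b\<close>. If \<open>F T q\<close> came after \<open>n\<close>, then \<open>q\<close> up to \<open>n\<close>, \<open>p\<close> from
  \<open>n\<close> to \<open>u\<close>, \<open>u v\<close>, and \<open>q\<close> backwards would give it tenacity at most \<open>T\<close>.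
\<close>

subsection \<open>Alternating paths and levels\<close>

text \<open>A non-empty set of extended naturals has a least element, so a finite level is the
  length of an actual path.\<close>

lemma INF_enat_attained:
  fixes f :: "'b \<Rightarrow> nat"
  assumes "(INF x\<in>A. enat (f x)) \<noteq> \<infinity>"
  obtains x where "x \<in> A" "(INF x\<in>A. enat (f x)) = enat (f x)"
proof -
  have "A \<noteq> {}" using assms by (auto simp: top_enat_def)
  then obtain x where "x \<in> (\<lambda>x. enat (f x)) ` A" by blast
  then have "(LEAST x. x \<in> (\<lambda>x. enat (f x)) ` A) \<in> (\<lambda>x. enat (f x)) ` A" by (rule LeastI)
  then have "(INF x\<in>A. enat (f x)) \<in> (\<lambda>x. enat (f x)) ` A"
    using \<open>A \<noteq> {}\<close> by (simp add: Inf_enat_def)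
  then show thesis using that by (auto simp only: image_iff)
qed

locale matched_graph =
  fixes V :: "'a set" and E M :: "'a set set"
  assumes graph: "finite_graph V E" and matching: "matching E M"
begin

abbreviation free :: "'a set" where "free \<equiv> unmatched V M"
abbreviation ev :: "'a \<Rightarrow> enat" where "ev \<equiv> evenlevel V E M"
abbreviation od :: "'a \<Rightarrow> enat" where "od \<equiv> oddlevel V E M"
abbreviation tn :: "'a \<Rightarrow> enat" where "tn \<equiv> tenacity V E M"

definition alt :: "'a list \<Rightarrow> bool" where
  "alt p \<longleftrightarrow> alternating_path V E M p \<and> hd p \<in> free"

lemma edge_subset:
  assumes "{u, v} \<in> E"
  shows "u \<in> V \<and> v \<in> V \<and> u \<noteq> v"
proof -
  have "{u, v} \<subseteq> V" "card {u, v} = 2" using graph assms unfolding finite_graph_def by blast+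
  then show ?thesis by (auto simp: card_insert_if split: if_splits)
qed

lemma matching_subset: "e \<in> M \<Longrightarrow> e \<in> E"
  using matching unfolding matching_def by auto

lemma mate_unique:
  assumes "{u, v} \<in> M" "{u, w} \<in> M"
  shows "v = w"
proof -
  have "disjoint M" using matching by (simp add: matching_def)
  then have "{u, v} = {u, w}"
    using assms disjointD[of M "{u, v}" "{u, w}"] by auto
  then show ?thesis by (auto simp: doubleton_eq_iff)
qed

lemma free_not_matched: "u \<in> free \<Longrightarrow> {u, v} \<notin> M"
  by (auto simp: unmatched_def)

text \<open>The first edge avoids \<open>M\<close> because the start is free, and membership in
  \<open>M\<close> flips at every step. From here on the parity of the position replaces
  alternation.\<close>

lemma alt_iff:
  "alt p \<longleftrightarrow> p \<noteq> [] \<and> set p \<subseteq> V \<and> distinct p \<and> hd p \<in> free \<and>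
     (\<forall>i. Suc i < length p \<longrightarrow> {p ! i, p ! Suc i} \<in> E \<and> ({p ! i, p ! Suc i} \<in> M \<longleftrightarrow> odd i))"
  (is "?L \<longleftrightarrow> ?R")
proof
  assume L: ?L
  have "{p ! i, p ! Suc i} \<in> M \<longleftrightarrow> odd i" if "Suc i < length p" for i
    using that
  proof (induction i)
    case 0
    then show ?case
      using L free_not_matched[of "p ! 0" "p ! 1"]
      by (auto simp: alt_def hd_conv_nth alternating_path_def simple_path_def)
  next
    case (Suc i)
    then show ?case using L by (auto simp: alt_def alternating_path_def)
  qed
  with L show ?R by (auto simp: alt_def alternating_path_def simple_path_def)
next
  assume ?R then show ?L by (auto simp: alt_def alternating_path_def simple_path_def)
qed

lemma alt_edge: "alt p \<Longrightarrow> Suc i < length p \<Longrightarrow> {p ! i, p ! Suc i} \<in> E"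
  and alt_matched: "alt p \<Longrightarrow> Suc i < length p \<Longrightarrow> ({p ! i, p ! Suc i} \<in> M) = odd i"
  and alt_distinct: "alt p \<Longrightarrow> distinct p"
  and alt_Nil: "alt p \<Longrightarrow> p \<noteq> []"
  and alt_set: "alt p \<Longrightarrow> set p \<subseteq> V"
  and alt_hd: "alt p \<Longrightarrow> hd p \<in> free"
  unfolding alt_iff by blast+

lemma alt_nth_0: "alt p \<Longrightarrow> p ! 0 \<in> free"
  using alt_hd alt_Nil by (metis hd_conv_nth)

lemma altI:
  assumes "p \<noteq> []" "set p \<subseteq> V" "distinct p" "hd p \<in> free"
    and "\<And>i. Suc i < length p \<Longrightarrow> {p ! i, p ! Suc i} \<in> E"
    and "\<And>i. Suc i < length p \<Longrightarrow> ({p ! i, p ! Suc i} \<in> M) = odd i"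
  shows "alt p"
  unfolding alt_iff using assms by blast

lemma alt_take:
  assumes "alt p" "k < length p"
  shows "alt (take (Suc k) p)" "last (take (Suc k) p) = p ! k" "path_length (take (Suc k) p) = k"
proof -
  show "alt (take (Suc k) p)"
  proof (rule altI)
    show "take (Suc k) p \<noteq> []" using assms by auto
    show "distinct (take (Suc k) p)" using alt_distinct[OF assms(1)] by simp
    show "hd (take (Suc k) p) \<in> free" using alt_hd[OF assms(1)] by simp
    show "set (take (Suc k) p) \<subseteq> V"
      using alt_set[OF assms(1)] set_take_subset[of "Suc k" p] by blast
  next
    fix i assume i: "Suc i < length (take (Suc k) p)"
    show "{take (Suc k) p ! i, take (Suc k) p ! Suc i} \<in> E"
      using i alt_edge[OF assms(1), of i] by simp
    show "({take (Suc k) p ! i, take (Suc k) p ! Suc i} \<in> M) = odd i"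
      using i alt_matched[OF assms(1), of i] by simp
  qed
  show "last (take (Suc k) p) = p ! k" "path_length (take (Suc k) p) = k"
    using assms by (auto simp: take_Suc_conv_app_nth path_length_def)
qed

lemma last_nth_path_length: "p \<noteq> [] \<Longrightarrow> last p = p ! path_length p"
  by (simp add: path_length_def last_conv_nth)

lemma length_path_length: "p \<noteq> [] \<Longrightarrow> length p = Suc (path_length p)"
  by (simp add: path_length_def)

lemma ev_le_path: "alt p \<Longrightarrow> even (path_length p) \<Longrightarrow> ev (last p) \<le> enat (path_length p)"
  unfolding evenlevel_def alternating_paths_to_def alt_def by (rule INF_lower) simp

lemma od_le_path: "alt p \<Longrightarrow> odd (path_length p) \<Longrightarrow> od (last p) \<le> enat (path_length p)"
  unfolding oddlevel_def alternating_paths_to_def alt_def by (rule INF_lower) simp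

lemma ev_le: "alt p \<Longrightarrow> k < length p \<Longrightarrow> even k \<Longrightarrow> ev (p ! k) \<le> enat k"
  using ev_le_path[of "take (Suc k) p"] alt_take[of p k] by simp

lemma od_le: "alt p \<Longrightarrow> k < length p \<Longrightarrow> odd k \<Longrightarrow> od (p ! k) \<le> enat k"
  using od_le_path[of "take (Suc k) p"] alt_take[of p k] by simp

text \<open>Only the parity of \<open>n\<close> matters. One notion of level path thereby covers the
  even and the odd case.\<close>

definition lvl :: "nat \<Rightarrow> 'a \<Rightarrow> enat" where
  "lvl n w = (if even n then ev w else od w)"

definition level_path :: "'a \<Rightarrow> 'a list \<Rightarrow> bool" where
  "level_path w p \<longleftrightarrow> alt p \<and> last p = w \<and> enat (path_length p) = lvl (path_length p) w"

lemma level_path_iff: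
  "level_path w p \<longleftrightarrow> evenlevel_path V E M w p \<or> oddlevel_path V E M w p"
  by (auto simp: level_path_def lvl_def evenlevel_path_def oddlevel_path_def
      alternating_paths_to_def alt_def)

lemma ev_attained:
  assumes "ev w \<noteq> \<infinity>"
  obtains p where "level_path w p" "even (path_length p)" "ev w = enat (path_length p)"
proof -
  obtain p where "p \<in> {p \<in> alternating_paths_to V E M w. even (path_length p)}"
    "ev w = enat (path_length p)"
    using INF_enat_attained[OF assms[unfolded evenlevel_def]] unfolding evenlevel_def by blast
  then show thesis
    using that[of p] by (simp add: level_path_def lvl_def alternating_paths_to_def alt_def)
qed

lemma od_attained:
  assumes "od w \<noteq> \<infinity>"
  obtains p where "level_path w p" "odd (path_length p)" "od w = enat (path_length p)"
proof -
  obtain p where "p \<in> {p \<in> alternating_paths_to V E M w. odd (path_length p)}"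
    "od w = enat (path_length p)"
    using INF_enat_attained[OF assms[unfolded oddlevel_def]] unfolding oddlevel_def by blast
  then show thesis
    using that[of p] by (simp add: level_path_def lvl_def alternating_paths_to_def alt_def)
qed

lemma tn_finiteD:
  assumes "tn w \<le> enat k"
  obtains a b where "ev w = enat a" "od w = enat b" "even a" "odd b" "tn w = enat (a + b)" "a + b \<le> k"
proof -
  have "ev w \<noteq> \<infinity>" "od w \<noteq> \<infinity>"
    using assms by (cases "ev w"; cases "od w"; simp add: tenacity_def)+
  obtain p where "level_path w p" "even (path_length p)" "ev w = enat (path_length p)"
    using \<open>ev w \<noteq> \<infinity>\<close> by (rule ev_attained)
  moreover obtain q where "level_path w q" "odd (path_length q)" "od w = enat (path_length q)"
    using \<open>od w \<noteq> \<infinity>\<close> by (rule od_attained)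
  ultimately show thesis using that[of "path_length p" "path_length q"] assms by (simp add: tenacity_def)
qed

text \<open>A finite tenacity is odd, being the sum of an even and an odd level; hence bounds may
  advance in steps of two.\<close>

lemma tn_le_pred:
  assumes "tn w < enat T" "odd T"
  shows "3 \<le> T" "tn w \<le> enat (T - 2)" "odd (T - 2)"
proof -
  have "tn w \<le> enat T" using assms by simp
  then obtain a b where *: "tn w = enat (a + b)" "even a" "odd b" using tn_finiteD by metis
  then have "a + b < T" "odd (a + b)" using assms by auto
  then have "a + b + 2 \<le> T" using \<open>odd T\<close> by presburger
  moreover have "1 \<le> a + b" using \<open>odd b\<close> by presburger
  ultimately show "3 \<le> T" "tn w \<le> enat (T - 2)" "odd (T - 2)" using * \<open>odd T\<close> by auto
qed

text \<open>An odd alternating path between free vertices has distinct ends and is therefore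
  augmenting, so the oddlevel of \<open>f\<close> alone is large enough.\<close>

lemma free_tn:
  assumes "f \<in> free"
  shows "min_augmenting_length V E M \<le> tn f"
proof -
  have "min_augmenting_length V E M \<le> od f"
  proof (cases "od f = \<infinity>")
    case False
    then obtain p where p: "level_path f p" "odd (path_length p)" "od f = enat (path_length p)"
      by (rule od_attained)
    then have a: "alt p" "last p = f" by (auto simp: level_path_def)
    have "hd p \<noteq> last p" 
      using a p(2) alt_distinct[OF a(1)] alt_Nil[OF a(1)]
      by (cases p) (auto simp: path_length_def split: if_splits)
    then have "augmenting_path V E M p"
      using a assms by (auto simp: augmenting_path_def alt_def)
    then show ?thesis unfolding p(3) min_augmenting_length_def by (intro INF_lower) simp
  qed auto
  also have "\<dots> \<le> tn f" by (simp add: tenacity_def)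
  finally show ?thesis .
qed

lemma ev_free:
  assumes "f \<in> free"
  shows "ev f = 0"
proof -
  have "alt [f]" using assms by (intro altI) (auto simp: unmatched_def)
  from ev_le_path[OF this] have "ev f \<le> enat 0" by (simp add: path_length_def)
  then show ?thesis by (simp add: enat_0)
qed

section \<open>Levels across matched and unmatched edges\<close>

lemma mate_notin_odd_path:
  assumes "alt p" "odd (path_length p)" "{u, last p} \<in> M"
  shows "u \<notin> set p"
proof
  assume "u \<in> set p"
  then obtain i where i: "i < length p" "u = p ! i" by (auto simp: in_set_conv_nth)
  define n where "n = path_length p"
  have n: "length p = Suc n" "last p = p ! n" 
    using alt_Nil[OF assms(1)] by (auto simp: n_def last_nth_path_length length_path_length)
  have ne: "u \<noteq> last p" using edge_subset matching_subset assms(3) by blast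
  then have "i < n" using i n by (cases "i = n") auto
  note d = nth_eq_iff_index_eq[OF alt_distinct[OF assms(1)]]
  show False
  \<comment> \<open>Before the end, an odd position is matched to its successor and a positive even
    one to its predecessor. Neither can be the last vertex, whose position is odd.\<close>
  proof (cases "odd i")
    case True
    then have "{p ! i, p ! Suc i} \<in> M" using alt_matched[OF assms(1)] n \<open>i < n\<close> by auto
    then have "p ! Suc i = p ! n" using mate_unique assms(3) i n by metis
    then have "Suc i = n" using d n \<open>i < n\<close> by simp
    with True have "even n" by (metis even_Suc)
    then show False using assms(2) n_def by simp
  next
    case False
    show False
    proof (cases i)
      case 0
      then show False using alt_nth_0[OF assms(1)] free_not_matched assms(3) i by metis
    next
      case (Suc j)
      then have "{p ! j, p ! i} \<in> M" using alt_matched[OF assms(1), of j] False n \<open>i < n\<close> by auto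
      then have "p ! j = p ! n" using mate_unique assms(3) i n by (metis insert_commute)
      then show False using d n \<open>i < n\<close> Suc by simp
    qed
  qed
qed

lemma alt_snoc:
  assumes "alt p" "v \<notin> set p" "{last p, v} \<in> E" "{last p, v} \<in> M \<longleftrightarrow> odd (path_length p)"
  shows "alt (p @ [v])"
proof -
  have "p \<noteq> []" using assms by (simp add: alt_Nil)
  moreover have "{(p @ [v]) ! i, (p @ [v]) ! Suc i} \<in> E \<and> ({(p @ [v]) ! i, (p @ [v]) ! Suc i} \<in> M \<longleftrightarrow> odd i)"
    if "Suc i < length (p @ [v])" for i
  proof (cases "Suc i < length p")
    case True
    then show ?thesis using alt_edge[OF assms(1)] alt_matched[OF assms(1)] by (simp add: nth_append)
  next
    case False
    then have "i = path_length p" "Suc i = length p" using that by (auto simp: path_length_def)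
    then show ?thesis using assms \<open>p \<noteq> []\<close> by (simp add: nth_append last_nth_path_length)
  qed
  ultimately show ?thesis
    using assms(2) edge_subset[OF assms(3)] alt_set[OF assms(1)] alt_distinct[OF assms(1)] alt_hd[OF assms(1)]
    by (intro altI) auto
qed

lemma even_path_butlast:
  assumes "alt p" "even (path_length p)" "{last p, u} \<in> M"
  shows "alt (butlast p)" "last (butlast p) = u" "path_length p = Suc (path_length (butlast p))"
    "p = butlast p @ [last p]"
proof -
  have ne: "p \<noteq> []" using assms by (simp add: alt_Nil)
  define n where "n = path_length p"
  have n: "length p = Suc n" "last p = p ! n" 
    using ne by (auto simp: n_def last_nth_path_length length_path_length)
  have "n \<noteq> 0"
  proof
    assume "n = 0"
    then have "last p \<in> free" using alt_nth_0[OF assms(1)] n by simp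
    then show False using assms(3) free_not_matched by blast
  qed
  then obtain m where m: "n = Suc m" by (cases n) auto
  have b: "butlast p = take (Suc m) p" using n m by (simp add: butlast_conv_take)
  show "alt (butlast p)" "path_length p = Suc (path_length (butlast p))"
    unfolding b using alt_take[OF assms(1), of m] n m n_def by auto
  have "{p ! m, p ! n} \<in> M" using alt_matched[OF assms(1), of m] n m assms(2) n_def by auto
  then have "p ! m = u" using mate_unique assms(3) n by (metis insert_commute)
  then show "last (butlast p) = u" unfolding b using alt_take[OF assms(1), of m] n m by auto
  show "p = butlast p @ [last p]" using ne by simp
qed

lemma odd_path_snoc_mate:
  assumes "alt p" "odd (path_length p)" "{last p, u} \<in> M"
  shows "alt (p @ [u])" "path_length (p @ [u]) = Suc (path_length p)"
proof -
  have "{u, last p} \<in> M" using assms(3) by (simp add: insert_commute)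
  then have "u \<notin> set p" by (rule mate_notin_odd_path[OF assms(1,2)])
  then show "alt (p @ [u])" using assms by (intro alt_snoc) (auto intro: matching_subset)
  show "path_length (p @ [u]) = Suc (path_length p)"
    using alt_Nil[OF assms(1)] by (simp add: path_length_def)
qed

text \<open>Appending \<open>u\<close> turns odd paths to \<open>v\<close> into even paths to
  \<open>u\<close> that are longer by one, and removing the last vertex reverses this.\<close>

lemma ev_mate:
  assumes "{u, v} \<in> M"
  shows "ev u = od v + 1"
proof (rule antisym)
  show "ev u \<le> od v + 1"
  proof (cases "od v = \<infinity>")
    case False
    then obtain p where p: "level_path v p" "odd (path_length p)" "od v = enat (path_length p)"
      by (rule od_attained)
    then have "alt p" "last p = v" by (auto simp: level_path_def)
    then show ?thesis using odd_path_snoc_mate[of p u] ev_le_path[of "p @ [u]"] assms p(2)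
      unfolding p(3) by (simp add: insert_commute one_enat_def)
  qed auto
  show "od v + 1 \<le> ev u"
  proof (cases "ev u = \<infinity>")
    case False
    then obtain p where p: "level_path u p" "even (path_length p)" "ev u = enat (path_length p)"
      by (rule ev_attained)
    then have "alt p" "last p = u" by (auto simp: level_path_def)
    then have "od v \<le> enat (path_length (butlast p))" "path_length p = Suc (path_length (butlast p))"
      using even_path_butlast[of p v] od_le_path[of "butlast p"] assms p(2) by auto
    then show ?thesis unfolding p(3) by (cases "od v") (auto simp: one_enat_def)
  qed auto
qed

lemma tn_mate:
  assumes "{u, v} \<in> M"
  shows "tn u = tn v" "tn u = od u + od v + 1"
proof -
  have u: "ev u = od v + 1" by (rule ev_mate[OF assms])
  have v: "ev v = od u + 1" using assms by (intro ev_mate) (simp add: insert_commute)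
  show "tn u = tn v" "tn u = od u + od v + 1"
    unfolding tenacity_def u v by (simp_all add: ac_simps)
qed

text \<open>Take an even level path to \<open>v\<close>. Either \<open>u\<close> lies on it and a
  prefix reaches \<open>u\<close>, or the edge can be appended.\<close>

lemma unmatched_edge_levels:
  assumes "{u, v} \<in> E" "{u, v} \<notin> M"
  shows "od u \<le> ev v + 1 \<or> ev u \<le> ev v"
proof (cases "ev v = \<infinity>")
  case False
  then obtain p where p: "level_path v p" "even (path_length p)" "ev v = enat (path_length p)"
    by (rule ev_attained)
  then have a: "alt p" "last p = v" by (auto simp: level_path_def)
  show ?thesis
  proof (cases "u \<in> set p")
    case True
    then obtain k where k: "k < length p" "u = p ! k" by (auto simp: in_set_conv_nth)
    then have "k \<le> path_length p" by (simp add: path_length_def)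
    then show ?thesis using ev_le[OF a(1) k(1)] od_le[OF a(1) k(1)] p(3) k(2)
      by (cases "even k") (auto simp: one_enat_def intro: order_trans)
  next
    case False
    then have "alt (p @ [u])" using a assms p by (intro alt_snoc) (auto simp: insert_commute)
    moreover have "path_length (p @ [u]) = Suc (path_length p)" using alt_Nil[OF a(1)] by (simp add: path_length_def)
    ultimately show ?thesis using od_le_path[of "p @ [u]"] p by (auto simp: one_enat_def)
  qed
qed auto

lemma tn_finite_mate:
  assumes "tn w < min_augmenting_length V E M" "w \<in> V"
  obtains u where "{w, u} \<in> M"
proof -
  have "w \<notin> free" using free_tn assms leD by blast
  then obtain e where "e \<in> M" "w \<in> e" using assms by (auto simp: unmatched_def)
  moreover from this have "card e = 2" using graph matching_subset by (auto simp: finite_graph_def)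
  ultimately show thesis using that by (auto simp: card_2_iff insert_commute)
qed

section \<open>The last vertex above a tenacity bound\<close>

definition last_above :: "nat \<Rightarrow> 'a list \<Rightarrow> 'a \<Rightarrow> bool" where
  "last_above \<tau> p b \<longleftrightarrow> (\<exists>i<length p. p ! i = b \<and> enat \<tau> < tn b \<and>
     (\<forall>j. i < j \<and> j < length p \<longrightarrow> tn (p ! j) \<le> enat \<tau>))"

lemma last_above_unique:
  assumes "last_above \<tau> p b" "last_above \<tau> p c"
  shows "b = c"
proof -
  obtain i j where i: "i < length p" "p ! i = b" "enat \<tau> < tn b" "\<And>l. i < l \<Longrightarrow> l < length p \<Longrightarrow> tn (p ! l) \<le> enat \<tau>"
    and j: "j < length p" "p ! j = c" "enat \<tau> < tn c" "\<And>l. j < l \<Longrightarrow> l < length p \<Longrightarrow> tn (p ! l) \<le> enat \<tau>"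
    using assms unfolding last_above_def by blast
  have "\<not> i < j" "\<not> j < i" using i j leD by blast+
  then show ?thesis using i j by (metis nat_neq_iff)
qed

text \<open>The free first vertex has tenacity at least the minimum augmenting length, so there is
  always a candidate.\<close>

lemma last_above_exists:
  assumes "alt p" "enat \<tau> < min_augmenting_length V E M"
  obtains b where "last_above \<tau> p b"
proof -
  let ?A = "{i. i < length p \<and> enat \<tau> < tn (p ! i)}"
  have "0 \<in> ?A" using assms free_tn[OF alt_nth_0[OF assms(1)]] alt_Nil[OF assms(1)] by auto
  then have "?A \<noteq> {}" by blast
  then have "Max ?A \<in> ?A" by (intro Max_in) auto
  moreover have "tn (p ! j) \<le> enat \<tau>" if "Max ?A < j" "j < length p" for j
  proof (rule ccontr)
    assume "\<not> tn (p ! j) \<le> enat \<tau>"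
    then have "j \<in> ?A" using that by simp
    then have "j \<le> Max ?A" by (intro Max_ge) auto
    then show False using that by linarith
  qed
  ultimately show thesis using that[of "p ! Max ?A"] unfolding last_above_def by blast
qed

lemma last_above_snoc:
  assumes "tn w \<le> enat \<tau>"
  shows "last_above \<tau> (p @ [w]) b \<longleftrightarrow> last_above \<tau> p b"
proof
  assume "last_above \<tau> (p @ [w]) b"
  then obtain i where i: "i < length (p @ [w])" "(p @ [w]) ! i = b" "enat \<tau> < tn b"
    "\<And>j. i < j \<Longrightarrow> j < length (p @ [w]) \<Longrightarrow> tn ((p @ [w]) ! j) \<le> enat \<tau>"
    unfolding last_above_def by blast
  have "i \<noteq> length p" using i assms by auto
  then have "i < length p" using i by simp
  moreover have "tn (p ! j) \<le> enat \<tau>" if "i < j" "j < length p" for j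
    using i(4)[of j] that by (simp add: nth_append)
  ultimately show "last_above \<tau> p b" using i unfolding last_above_def by (auto simp: nth_append)
next
  assume "last_above \<tau> p b"
  then show "last_above \<tau> (p @ [w]) b"
    using assms unfolding last_above_def by (auto simp: nth_append intro: less_SucI)
qed

lemma last_above_take:
  assumes "k < length p" "\<And>j. k < j \<Longrightarrow> j < length p \<Longrightarrow> tn (p ! j) \<le> enat \<tau>"
  shows "last_above \<tau> (take (Suc k) p) b \<longleftrightarrow> last_above \<tau> p b"
proof
  assume "last_above \<tau> (take (Suc k) p) b"
  then obtain i where i: "i \<le> k" "p ! i = b" "enat \<tau> < tn b"
    "\<And>j. i < j \<Longrightarrow> j \<le> k \<Longrightarrow> tn (p ! j) \<le> enat \<tau>"
    using assms(1) unfolding last_above_def by (auto simp: less_Suc_eq_le)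
  then show "last_above \<tau> p b"
    unfolding last_above_def using assms by (intro exI[of _ i]) (metis leI le_less_trans)
next
  assume "last_above \<tau> p b"
  then obtain i where i: "i < length p" "p ! i = b" "enat \<tau> < tn b"
    "\<And>j. i < j \<Longrightarrow> j < length p \<Longrightarrow> tn (p ! j) \<le> enat \<tau>"
    unfolding last_above_def by blast
  then have "i \<le> k" using assms(2)[of i] leD by (metis leI)
  then show "last_above \<tau> (take (Suc k) p) b"
    unfolding last_above_def using i assms(1) by (intro exI[of _ i]) auto
qed

lemma last_above_self:
  assumes "p \<noteq> []" "enat \<tau> < tn (last p)"
  shows "last_above \<tau> p (last p)"
  unfolding last_above_def using assms
  by (intro exI[of _ "path_length p"]) (auto simp: last_nth_path_length length_path_length)

text \<open>Walk along \<open>q\<close>, cross the edge and return along \<open>p\<close> to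
  position \<open>i\<close>. As \<open>i\<close> is even, this path is odd and the prefix of
  \<open>p\<close> up to \<open>i\<close> is even; their lengths add up to the bound, whatever
  \<open>i\<close> is.\<close>

lemma join_paths:
  assumes p: "alt p" and q: "alt q" and e: "{last q, last p} \<in> E"
    and m: "({last q, last p} \<in> M) = odd (path_length q)"
    and par: "even (path_length p) = even (path_length q)"
    and i: "i < length p" "even i" and disj: "set q \<inter> set (drop i p) = {}"
  shows "ev (p ! i) + od (p ! i) \<le> enat (path_length p + path_length q + 1)"
proof -
  define n where "n = path_length p"
  define k where "k = path_length q"
  have lp: "length p = Suc n" "last p = p ! n" and lq: "length q = Suc k" "last q = q ! k"
    using alt_Nil[OF p] alt_Nil[OF q]
    by (auto simp: n_def k_def length_path_length last_nth_path_length)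
  define r where "r = q @ rev (drop i p)"
  have r1: "r ! j = q ! j" if "j \<le> k" for j using that lq by (simp add: r_def nth_append)
  have r2: "r ! (Suc k + j) = p ! (n - j)" if "j \<le> n - i" for j
    using that lp lq i by (simp add: r_def nth_append rev_nth)
  have lr: "length r = Suc (k + 1 + (n - i))" using lp lq i by (simp add: r_def)
  have step: "{r ! j, r ! Suc j} \<in> E \<and> ({r ! j, r ! Suc j} \<in> M) = odd j" if "Suc j < length r" for j
  proof -
    consider "j < k" | "j = k" | l where "j = Suc k + l" by (metis less_iff_Suc_add add_Suc linorder_less_linear)
    then show ?thesis
    proof cases
      case 1
      then show ?thesis using r1[of j] r1[of "Suc j"] alt_edge[OF q, of j] alt_matched[OF q, of j] lq by simp
    next
      case 2
      then show ?thesis using r1[of j] r2[of 0] e m lp lq by (simp add: k_def)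
    next
      case (3 l)
      then have l: "Suc l \<le> n - i" using that lr by simp
      define h where "h = n - Suc l"
      have h: "n - l = Suc h" "n = h + l + 1" using l h_def by auto
      have "r ! j = p ! Suc h" using r2[of l] l 3 h by simp
      moreover have "r ! Suc j = p ! h" using r2[of "Suc l"] l 3 h_def by simp
      moreover have "odd j = odd h" using par 3 h unfolding n_def[symmetric] k_def[symmetric] by auto
      ultimately show ?thesis using alt_edge[OF p, of h] alt_matched[OF p, of h] lp h
        by (simp add: insert_commute)
    qed
  qed
  have "alt r"
  proof (rule altI)
    show "r \<noteq> []" using lr by auto
    show "set r \<subseteq> V" using alt_set[OF p] alt_set[OF q] set_drop_subset[of i p] by (auto simp: r_def)
    show "distinct r" using alt_distinct[OF p] alt_distinct[OF q] disj by (auto simp: r_def)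
    show "hd r \<in> free" using alt_hd[OF q] alt_Nil[OF q] by (simp add: r_def)
  qed (use step in auto)
  moreover have "last r = p ! i" using lp i by (simp add: r_def last_rev hd_drop_conv_nth)
  moreover have pl: "path_length r = k + 1 + (n - i)" using lr by (simp add: path_length_def)
  moreover have "odd (k + 1 + (n - i))" using par i lp unfolding n_def[symmetric] k_def[symmetric] by auto
  ultimately have "od (p ! i) \<le> enat (k + 1 + (n - i))" using od_le_path[of r] by simp
  moreover have "ev (p ! i) \<le> enat i" using ev_le[OF p i] .
  ultimately have "ev (p ! i) + od (p ! i) \<le> enat i + enat (k + 1 + (n - i))" by (rule add_mono[rotated])
  also have "\<dots> = enat (n + k + 1)" using lp i by simp
  finally show ?thesis by (simp add: n_def k_def)
qed

text \<open>The two prefixes reach the same vertex after the same number of steps, so replacing one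
  by the other keeps the positions, and with them the alternation and the length.\<close>

lemma splice_paths:
  assumes p: "alt p" and q: "alt q" and i: "i < length p" "i < length q" "p ! i = q ! i"
    and disj: "set (take (Suc i) q) \<inter> set (drop (Suc i) p) = {}"
  shows "alt (take (Suc i) q @ drop (Suc i) p)" "last (take (Suc i) q @ drop (Suc i) p) = last p"
    "path_length (take (Suc i) q @ drop (Suc i) p) = path_length p"
proof -
  let ?r = "take (Suc i) q @ drop (Suc i) p"
  have lr: "length ?r = length p" using i by simp
  have nth: "?r ! j = (if j \<le> i then q ! j else p ! j)" if "j < length p" for j
  proof -
    have "length (take (Suc i) q) = Suc i" using i by simp
    then show ?thesis using that by (auto simp: nth_append)
  qed
  have step: "{?r ! j, ?r ! Suc j} \<in> E \<and> ({?r ! j, ?r ! Suc j} \<in> M) = odd j" if "Suc j < length ?r" for j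
  proof -
    have "Suc j < length p" using that lr by simp
    consider "j < i" | "j = i" | "i < j" by linarith
    then show ?thesis
    proof cases
      case 1
      then show ?thesis using nth[of j] nth[of "Suc j"] \<open>Suc j < length p\<close> i
          alt_edge[OF q, of j] alt_matched[OF q, of j] by simp
    next
      case 2
      then show ?thesis using nth[of j] nth[of "Suc j"] \<open>Suc j < length p\<close> i
          alt_edge[OF p, of j] alt_matched[OF p, of j] by simp
    next
      case 3
      then show ?thesis using nth[of j] nth[of "Suc j"] \<open>Suc j < length p\<close>
          alt_edge[OF p, of j] alt_matched[OF p, of j] by simp
    qed
  qed
  show "alt ?r"
  proof (rule altI)
    show "?r \<noteq> []" using lr i by auto
    show "set ?r \<subseteq> V"
      using alt_set[OF p] alt_set[OF q] set_drop_subset[of "Suc i" p] set_take_subset[of "Suc i" q] by auto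
    show "distinct ?r" using alt_distinct[OF p] alt_distinct[OF q] disj by auto
    show "hd ?r \<in> free" using alt_hd[OF q] alt_Nil[OF q] by simp
  qed (use step in auto)
  show "path_length ?r = path_length p" using lr by (simp add: path_length_def)
  show "last ?r = last p"
  proof (cases "Suc i < length p")
    case False
    then have "Suc i = length p" using i by simp
    then have "last p = p ! i" using i by (metis diff_Suc_1 last_conv_nth length_0_conv nat.distinct(1))
    then show ?thesis using \<open>Suc i = length p\<close> i alt_take(2)[OF q i(2)] by simp
  qed simp
qed

lemma level_path_butlast:
  assumes "level_path w p" "even (path_length p)" "{w, w'} \<in> M"
  shows "level_path w' (butlast p)" "path_length p = Suc (path_length (butlast p))" "p = butlast p @ [w]"
proof -
  have p: "alt p" "last p = w" "enat (path_length p) = ev w"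
    using assms by (auto simp: level_path_def lvl_def)
  have b: "alt (butlast p)" "last (butlast p) = w'" "path_length p = Suc (path_length (butlast p))"
    "p = butlast p @ [w]"
    using even_path_butlast[of p w'] p assms by auto
  moreover have "ev w = od w' + 1" using assms by (intro ev_mate)
  then have "enat (path_length (butlast p)) = od w'" using p b(3) by (cases "od w'") (auto simp: one_enat_def)
  moreover have "odd (path_length (butlast p))" using b(3) assms(2) by simp
  ultimately show "level_path w' (butlast p)" "path_length p = Suc (path_length (butlast p))" "p = butlast p @ [w]"
    by (simp_all add: level_path_def lvl_def)
qed

text \<open>An even level path to \<open>w\<close> arrives from the mate. Cutting off
  \<open>w\<close>, which is not above \<open>\<tau>\<close>, leaves an odd level path to the mate
  with the same last vertex above \<open>\<tau>\<close>.\<close>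

lemma level_path_reduce:
  assumes "level_path w p" "{w, w'} \<in> M" "tn w \<le> enat \<tau>" "last_above \<tau> p b"
  obtains u p' where "u = w \<or> u = w'" "level_path u p'" "odd (path_length p')" "last_above \<tau> p' b"
    "path_length p' \<le> path_length p" "even (path_length p) \<Longrightarrow> path_length p' < path_length p"
proof (cases "even (path_length p)")
  case True
  note b = level_path_butlast[OF assms(1) True assms(2)]
  have "last_above \<tau> (butlast p) b" using last_above_snoc[OF assms(3), of "butlast p" b] assms(4) b(3) by simp
  then show thesis using that[of w' "butlast p"] b True by simp
next
  case False
  then show thesis using that[of w p] assms by simp
qed

text \<open>A choice, because uniqueness is only available once \<open>\<tau>\<close> has been
  treated. Vertices above \<open>\<tau>\<close> are their own base, so that a class contains its
  base.\<close>

definition base :: "nat \<Rightarrow> 'a \<Rightarrow> 'a" where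
  "base \<tau> w = (if tn w \<le> enat \<tau> then SOME b. \<exists>p. level_path w p \<and> last_above \<tau> p b else w)"

lemma base_above: "enat \<tau> < tn w \<Longrightarrow> base \<tau> w = w"
  by (auto simp: base_def dest: leD)

lemma level_path_exists:
  assumes "tn w \<le> enat \<tau>"
  obtains p where "level_path w p" "odd (path_length p)"
proof -
  obtain b where "od w = enat b" using assms by (rule tn_finiteD)
  then have "od w \<noteq> \<infinity>" by simp
  then show thesis using that by (rule od_attained)
qed

lemma level_path_in_V: "level_path w p \<Longrightarrow> w \<in> V"
  using alt_set alt_Nil last_in_set unfolding level_path_def by blast

lemma base_wrt_eq:
  assumes "last_above \<tau> p b" "tn v = enat \<tau>"
  shows "base_wrt V E M p v = b"
proof -
  obtain i where i: "i < length p" "p ! i = b" "enat \<tau> < tn b" "\<And>j. i < j \<Longrightarrow> j < length p \<Longrightarrow> tn (p ! j) \<le> enat \<tau>"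
    using assms unfolding last_above_def by blast
  have "Max {i. i < length p \<and> tn v < tn (p ! i)} = i"
  proof (rule Max_eqI)
    fix j assume "j \<in> {i. i < length p \<and> tn v < tn (p ! i)}"
    then show "j \<le> i" using i(4)[of j] assms(2) by (metis leD leI mem_Collect_eq)
  qed (use i assms in auto)
  then show ?thesis using i by (simp add: base_wrt_def)
qed

end

subsection \<open>The dual solution\<close>

text \<open>Applied with \<open>t\<close> the tenacity of a vertex or of an edge; the odd
  \<open>\<sigma>\<close> counted are the layers in which it lies inside a class.\<close>

lemma sum_odd_ge:
  fixes t T :: nat
  assumes "odd t" "odd T" "t \<le> T"
  shows "2 * (\<Sum>\<sigma> | odd \<sigma> \<and> \<sigma> < T. of_bool (t \<le> \<sigma>)) = int T - int t"
proof -
  have *: "(\<Sum>\<sigma> | odd \<sigma> \<and> \<sigma> < t + 2 * m. of_bool (t \<le> \<sigma>)) = int m" for m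
  proof (induction m)
    case 0
    have "(\<Sum>\<sigma> | odd \<sigma> \<and> \<sigma> < t. of_bool (t \<le> \<sigma>)) = (0 :: int)"
      by (rule sum.neutral) auto
    then show ?case by simp
  next
    case (Suc m)
    have "{\<sigma>. odd \<sigma> \<and> \<sigma> < t + 2 * Suc m} = insert (t + 2 * m) {\<sigma>. odd \<sigma> \<and> \<sigma> < t + 2 * m}"
      using \<open>odd t\<close> by (auto simp: less_Suc_eq)
    then show ?case using Suc by simp
  qed
  obtain m where "T = t + 2 * m"
    using assms by (metis dvdE even_diff_nat le_add_diff_inverse odd_add)
  then show ?thesis using *[of m] by simp
qed

lemma nth_notin_take: "distinct xs \<Longrightarrow> k < length xs \<Longrightarrow> j \<le> k \<Longrightarrow> xs ! k \<notin> set (take j xs)"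
  by (auto simp: in_set_conv_nth nth_eq_iff_index_eq)

lemma take_Suc_mem: "x \<in> set (take k p) \<Longrightarrow> x \<in> set (take (Suc k) p)"
  by (meson le_SucI order_refl set_take_subset_set_take subsetD)

text \<open>The induction hypothesis for \<open>T\<close>: \<open>\<beta> \<sigma>\<close> is the
  base function of each smaller odd \<open>\<sigma>\<close>, known only through the properties on
  which the dual solution rests. It is instantiated with \<open>base\<close> at the end.\<close>

locale stage = matched_graph +
  fixes T :: nat and \<beta> :: "nat \<Rightarrow> 'a \<Rightarrow> 'a"
  assumes odd_T: "odd T" and T_less: "enat T < min_augmenting_length V E M"
    and unmatched_edge_base: "\<And>\<sigma> u v. \<lbrakk>odd \<sigma>; \<sigma> < T; {u, v} \<in> E; {u, v} \<notin> M; ev u + ev v + 1 \<le> enat \<sigma>\<rbrakk>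
      \<Longrightarrow> \<beta> \<sigma> u = \<beta> \<sigma> v"
    and matched_edge_base: "\<And>\<sigma> u v. \<lbrakk>odd \<sigma>; \<sigma> < T; {u, v} \<in> M; tn u \<le> enat \<sigma>\<rbrakk> \<Longrightarrow> \<beta> \<sigma> u = \<beta> \<sigma> v"
    and base_fixed: "\<And>\<sigma> u. \<lbrakk>odd \<sigma>; \<sigma> < T; enat \<sigma> < tn u\<rbrakk> \<Longrightarrow> \<beta> \<sigma> u = u"
    and base_tn: "\<And>\<sigma> u. \<lbrakk>odd \<sigma>; \<sigma> < T\<rbrakk> \<Longrightarrow> enat \<sigma> < tn (\<beta> \<sigma> u)"
begin

text \<open>Twice the dual variable. For tenacity at least \<open>T\<close> it only depends on the smaller of the two
  levels, and the value \<open>-1\<close> keeps matched edges tight outside the search.\<close>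

definition Y :: "'a \<Rightarrow> int" where
  "Y v = (if ev v \<le> enat ((T + 1) div 2) \<or> tn v < enat T then int T - 2 * int (the_enat (ev v))
    else if od v \<le> enat ((T - 1) div 2) then 2 * int (the_enat (od v)) - int T else - 1)"

definition S :: "nat set" where "S = {\<sigma>. odd \<sigma> \<and> \<sigma> < T}"

definition num :: "'a \<Rightarrow> 'a \<Rightarrow> int" where
  "num u v = (\<Sum>\<sigma>\<in>S. of_bool (\<beta> \<sigma> u = \<beta> \<sigma> v))"

lemma finite_S: "finite S" by (simp add: S_def)

lemma num_nonneg: "0 \<le> num u v" by (simp add: num_def sum_nonneg)

lemma ev_enatE:
  assumes "ev v \<noteq> \<infinity>"
  obtains a where "ev v = enat a" "even a"
  using ev_attained[OF assms] by metis

lemma od_enatE: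
  assumes "od v \<noteq> \<infinity>"
  obtains a where "od v = enat a" "odd a"
  using od_attained[OF assms] by metis

text \<open>The value comes from the evenlevel in case \<open>E\<close>, from the oddlevel in case
  \<open>I\<close>, and is the default in case \<open>N\<close>. Levels in use are finite, hence
  attained, which gives their parity.\<close>

lemma Y_cases:
  obtains (E) a where "ev v = enat a" "even a" "Y v = int T - 2 * int a"
      "a \<le> (T + 1) div 2 \<or> tn v < enat T"
  | (I) b where "enat ((T + 1) div 2) < ev v" "enat T \<le> tn v" "od v = enat b" "odd b"
      "b \<le> (T - 1) div 2" "Y v = 2 * int b - int T"
  | (N) "enat ((T + 1) div 2) < ev v" "enat T \<le> tn v" "enat ((T - 1) div 2) < od v" "Y v = - 1"
proof (cases "ev v \<le> enat ((T + 1) div 2) \<or> tn v < enat T")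
  case True
  then have "ev v \<noteq> \<infinity>" by (cases "ev v") (auto simp: tenacity_def)
  then obtain a where "ev v = enat a" "even a" by (rule ev_enatE)
  then show thesis using True by (intro E[of a]) (auto simp: Y_def)
next
  case False
  show thesis
  proof (cases "od v \<le> enat ((T - 1) div 2)")
    case True
    then have "od v \<noteq> \<infinity>" by (cases "od v") auto
    then obtain b where "od v = enat b" "odd b" by (rule od_enatE)
    then show thesis using True False by (intro I[of b]) (auto simp: Y_def)
  next
    case F: False
    then show thesis using False by (intro N) (auto simp: Y_def)
  qed
qed

text \<open>Each \<open>\<sigma>\<close>-class carries the dual variable \<open>-2\<close>, that is \<open>-4\<close> after doubling. Edges have cost \<open>1\<close>
  outside and \<open>-1\<close> inside the matching.\<close>

lemma unmatched_edge_feasible: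
  assumes "{u, v} \<in> E" "{u, v} \<notin> M"
  shows "Y u + Y v \<le> 2 + 4 * num u v"
proof -
  have half: "(T - 1) div 2 + 1 = (T + 1) div 2" "2 * ((T + 1) div 2) = T + 1"
    using odd_T by presburger+
  have neg: "Y w \<le> - 1" if "enat ((T + 1) div 2) < ev w" "enat T \<le> tn w" for w
  proof (cases w rule: Y_cases)
    case (E a)
    then show ?thesis using that by auto
  next
    case (I b)
    then show ?thesis using half by linarith
  qed auto
  \<comment> \<open>For \<open>T \<le> 2 * a + 3\<close> the bounds \<open>3\<close> and
    \<open>-1\<close> suffice. Otherwise the edge yields an oddlevel of \<open>v\<close> of at most
    \<open>a + 1\<close>, so \<open>Y v\<close> is at most \<open>2 * (a + 1) - T\<close>.\<close>
  have mixed: "Y u + Y v \<le> 2"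
    if uv: "{u, v} \<in> E" "{u, v} \<notin> M" and a: "ev u = enat a" "Y u = int T - 2 * int a"
      and v: "enat ((T + 1) div 2) < ev v" "enat T \<le> tn v" for u v a
  proof (cases "T \<le> 2 * a + 3")
    case True
    then show ?thesis using neg[OF v] a by linarith
  next
    case False
    have "od v \<le> ev u + 1 \<or> ev v \<le> ev u"
      using uv by (intro unmatched_edge_levels) (auto simp: insert_commute)
    moreover have "\<not> ev v \<le> ev u"
    proof
      assume "ev v \<le> ev u"
      then have "enat ((T + 1) div 2) < enat a" using less_le_trans[OF v(1)] a(1) by metis
      then show False using False by simp
    qed
    ultimately have o: "od v \<le> enat (a + 1)" using a(1) by (simp add: one_enat_def)
    show ?thesis
    proof (cases v rule: Y_cases)
      case (E c)
      then show ?thesis using v by auto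
    next
      case (I b)
      then show ?thesis using o a by auto
    next
      case N
      then have "enat ((T - 1) div 2) < enat (a + 1)" using less_le_trans[OF N(3) o] by simp
      then show ?thesis using False by simp
    qed
  qed
  show ?thesis
  proof (cases u rule: Y_cases)
    case u: (E a)
    show ?thesis
    proof (cases v rule: Y_cases)
      case v: (E b)
      show ?thesis
      proof (cases "T \<le> a + b + 1")
        case True
        then show ?thesis using u v num_nonneg[of u v] by linarith
      next
        case False
        \<comment> \<open>The edge has tenacity \<open>a + b + 1\<close>, so its ends share a class
          in every layer from there on; these layers pay exactly for the excess of
          \<open>Y u + Y v\<close> over \<open>2\<close>.\<close>
        have "(\<Sum>\<sigma>\<in>S. of_bool (a + b + 1 \<le> \<sigma>)) \<le> num u v"
          unfolding num_def
        proof (rule sum_mono)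
          fix \<sigma> assume "\<sigma> \<in> S"
          then have "\<beta> \<sigma> u = \<beta> \<sigma> v" if "a + b + 1 \<le> \<sigma>"
            using that assms u(1) v(1)
            by (intro unmatched_edge_base) (auto simp: S_def one_enat_def)
          then show "of_bool (a + b + 1 \<le> \<sigma>) \<le> (of_bool (\<beta> \<sigma> u = \<beta> \<sigma> v) :: int)" by simp
        qed
        moreover have "2 * (\<Sum>\<sigma>\<in>S. of_bool (a + b + 1 \<le> \<sigma>)) = int T - int (a + b + 1)"
          unfolding S_def using u v False odd_T by (intro sum_odd_ge) auto
        ultimately show ?thesis using u(3) v(3) by linarith
      qed
    next
      case (I b)
      then show ?thesis using mixed[OF assms u(1,3)] num_nonneg[of u v] by linarith
    next
      case N
      then show ?thesis using mixed[OF assms u(1,3)] num_nonneg[of u v] by linarith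
    qed
  next
    case u: (I c)
    show ?thesis
    proof (cases v rule: Y_cases)
      case (E a)
      then show ?thesis using mixed[of v u a] assms u(1,2) num_nonneg[of u v]
        by (simp add: insert_commute)
    next
      case (I b)
      then show ?thesis using neg[of v] neg[OF u(1,2)] num_nonneg[of u v] by linarith
    next
      case N
      then show ?thesis using neg[of v] neg[OF u(1,2)] num_nonneg[of u v] by linarith
    qed
  next
    case u: N
    show ?thesis
    proof (cases v rule: Y_cases)
      case (E a)
      then show ?thesis using mixed[of v u a] assms u(1,2) num_nonneg[of u v]
        by (simp add: insert_commute)
    next
      case (I b)
      then show ?thesis using neg[of v] neg[OF u(1,2)] num_nonneg[of u v] by linarith
    next
      case N
      then show ?thesis using neg[of v] neg[OF u(1,2)] num_nonneg[of u v] by linarith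
    qed
  qed
qed

lemma matched_sim:
  assumes "\<sigma> \<in> S" "{u, v} \<in> M"
  shows "\<beta> \<sigma> u = \<beta> \<sigma> v \<longleftrightarrow> tn u \<le> enat \<sigma>"
proof (cases "tn u \<le> enat \<sigma>")
  case True
  then show ?thesis using matched_edge_base[of \<sigma> u v] assms by (simp add: S_def)
next
  case False
  then have "enat \<sigma> < tn u" "enat \<sigma> < tn v" using tn_mate[OF assms(2)] by auto
  then have "\<beta> \<sigma> u = u" "\<beta> \<sigma> v = v" using base_fixed assms(1) by (auto simp: S_def)
  moreover have "u \<noteq> v" using edge_subset matching_subset assms(2) by blast
  ultimately show ?thesis using False by simp
qed

lemma num_matched:
  assumes "{u, v} \<in> M"
  shows "num u v = (\<Sum>\<sigma>\<in>S. of_bool (tn u \<le> enat \<sigma>))"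
  unfolding num_def using matched_sim[OF _ assms] by (intro sum.cong) auto

lemma sum_tn_ge:
  assumes "enat T \<le> tn u"
  shows "(\<Sum>\<sigma>\<in>S. of_bool (tn u \<le> enat \<sigma>)) = (0 :: int)"
proof (rule sum.neutral, safe)
  fix \<sigma> assume "\<sigma> \<in> S"
  then have "enat \<sigma> < tn u" using less_le_trans[OF _ assms, of "enat \<sigma>"] by (simp add: S_def)
  then show "of_bool (tn u \<le> enat \<sigma>) = (0 :: int)" by simp
qed

lemma sum_tn_less:
  assumes "tn u = enat t" "t \<le> T" "odd t"
  shows "2 * (\<Sum>\<sigma>\<in>S. of_bool (tn u \<le> enat \<sigma>)) = int T - int t"
  using sum_odd_ge[of t T] assms odd_T by (simp add: S_def)

text \<open>The evenlevel of a vertex is one more than the oddlevel of its mate. The two thresholds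
  in \<open>Y\<close> differ by one for this reason, so the branches taken at the two ends always
  fit together.\<close>

lemma matched_edge_tight:
  assumes "{u, v} \<in> M"
  shows "Y u + Y v = 4 * num u v - 2"
proof -
  have half: "(T - 1) div 2 + 1 = (T + 1) div 2" "2 * ((T + 1) div 2) = T + 1"
    using odd_T by presburger+
  have m: "{v, u} \<in> M" using assms by (simp add: insert_commute)
  have eu: "ev u = od v + 1" by (rule ev_mate[OF assms])
  have evv: "ev v = od u + 1" by (rule ev_mate[OF m])
  have tu: "tn u = tn v" "tn u = od u + od v + 1" using tn_mate[OF assms] by auto
  show ?thesis
  proof (cases "tn u < enat T")
    case True
    then obtain a b where ab: "ev u = enat a" "od u = enat b" "even a" "odd b" "tn u = enat (a + b)" "a + b \<le> T"
      using tn_finiteD[of u T] by (metis less_imp_le)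
    have "ev v = enat (b + 1)" using evv ab by (simp add: one_enat_def)
    then have "Y v = int T - 2 * int (b + 1)" using True tu by (simp add: Y_def)
    moreover have "Y u = int T - 2 * int a" using True ab by (simp add: Y_def)
    moreover have "2 * num u v = int T - int (a + b)"
      using num_matched[OF assms] sum_tn_less[of u "a + b"] ab by simp
    ultimately show ?thesis by simp
  next
    case False
    then have n: "num u v = 0" using num_matched[OF assms] sum_tn_ge[of u] by simp
    have "Y u + Y v = - 2"
    proof (cases "ev u \<le> enat ((T + 1) div 2)")
      case eu': True
      then obtain c where c: "od v = enat c" using eu by (cases "od v") auto
      then have a: "ev u = enat (c + 1)" using eu by (simp add: one_enat_def)
      then have Yu: "Y u = int T - 2 * int (c + 1)" using eu' by (simp add: Y_def)
      have cT: "c + 1 \<le> (T + 1) div 2" using eu' a by simp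
      show ?thesis
      proof (cases "ev v \<le> enat ((T + 1) div 2)")
        case ev': True
        then obtain d where d: "od u = enat d" using evv by (cases "od u") auto
        then have b: "ev v = enat (d + 1)" using evv by (simp add: one_enat_def)
        then have "Y v = int T - 2 * int (d + 1)" using ev' by (simp add: Y_def)
        \<comment> \<open>Both evenlevels are at most \<open>(T + 1) / 2\<close>, which bounds the
          tenacity by \<open>T\<close>; being at least \<open>T\<close>, it equals
          \<open>T\<close>.\<close>
        moreover have "tn u = enat (d + c + 1)" using tu(2) c d by (simp add: one_enat_def)
        then have "T \<le> c + d + 1" using False by simp
        moreover have "d + 1 \<le> (T + 1) div 2" using ev' b by simp
        ultimately have "Y v = int T - 2 * int (d + 1)" "T = c + d + 1"
          using cT half by linarith+
        then show ?thesis using Yu by simp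
      next
        case False2: False
        have "od v \<le> enat ((T - 1) div 2)" using c cT half by simp
        then have "Y v = 2 * int c - int T" using False2 False tu c by (simp add: Y_def)
        then show ?thesis using Yu by simp
      qed
    next
      case neu: False
      then have nov: "\<not> od v \<le> enat ((T - 1) div 2)" using eu half
        by (cases "od v") (auto simp: one_enat_def)
      show ?thesis
      proof (cases "ev v \<le> enat ((T + 1) div 2)")
        case ev': True
        then obtain d where d: "od u = enat d" using evv by (cases "od u") auto
        then have b: "ev v = enat (d + 1)" using evv by (simp add: one_enat_def)
        then have "Y v = int T - 2 * int (d + 1)" using ev' by (simp add: Y_def)
        moreover have "od u \<le> enat ((T - 1) div 2)" using d b ev' half by simp
        then have "Y u = 2 * int d - int T" using neu False d by (simp add: Y_def)
        ultimately show ?thesis by simp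
      next
        case nev: False
        then have nou: "\<not> od u \<le> enat ((T - 1) div 2)" using evv half
          by (cases "od u") (auto simp: one_enat_def)
        have "Y u = - 1" "Y v = - 1" using nou nov neu nev False tu by (auto simp: Y_def)
        then show ?thesis by simp
      qed
    qed
    then show ?thesis using n by simp
  qed
qed

lemma Y_free: "f \<in> free \<Longrightarrow> Y f = int T"
  using ev_free[of f] by (simp add: Y_def zero_enat_def)

lemma tn_free: "f \<in> free \<Longrightarrow> enat T < tn f"
  using free_tn[of f] T_less by simp

text \<open>The number of unmatched minus the number of matched edges inside \<open>\<sigma>\<close>-classes among the first \<open>k\<close>
  edges of \<open>p\<close>.\<close>

definition K :: "'a list \<Rightarrow> nat \<Rightarrow> nat \<Rightarrow> int" where
  "K p \<sigma> k = (\<Sum>i<k. (if even i then 1 else - 1) * of_bool (\<beta> \<sigma> (p ! i) = \<beta> \<sigma> (p ! Suc i)))"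

text \<open>The total slack in the dual constraints of the first \<open>k\<close> edges. Matched
  edges are tight and contribute nothing; the term \<open>- int T\<close> cancels the potential of
  the free start.\<close>

definition slack :: "'a list \<Rightarrow> nat \<Rightarrow> int" where
  "slack p k = 2 * int k - int T + (if even k then Y (p ! k) else - Y (p ! k)) + 4 * (\<Sum>\<sigma>\<in>S. K p \<sigma> k)"

lemma sum_K_Suc:
  "(\<Sum>\<sigma>\<in>S. K p \<sigma> (Suc k)) = (\<Sum>\<sigma>\<in>S. K p \<sigma> k) + (if even k then 1 else - 1) * num (p ! k) (p ! Suc k)"
  unfolding K_def num_def by (simp add: sum.distrib sum_negf)

lemma slack_0: "alt p \<Longrightarrow> slack p 0 = 0"
  using alt_nth_0[of p] by (simp add: slack_def K_def Y_free)

lemma slack_step: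
  assumes "alt p" "Suc k < length p"
  shows "slack p k \<le> slack p (Suc k)"
proof (cases "even k")
  case True
  then have "Y (p ! k) + Y (p ! Suc k) \<le> 2 + 4 * num (p ! k) (p ! Suc k)"
    using alt_edge[OF assms] alt_matched[OF assms] by (intro unmatched_edge_feasible) auto
  then show ?thesis using True by (simp add: slack_def sum_K_Suc)
next
  case False
  then have "Y (p ! k) + Y (p ! Suc k) = 4 * num (p ! k) (p ! Suc k) - 2"
    using alt_edge[OF assms] alt_matched[OF assms] by (intro matched_edge_tight) auto
  then show ?thesis using False by (simp add: slack_def sum_K_Suc)
qed

lemma slack_mono:
  assumes "alt p" "j < length p" "i \<le> j"
  shows "slack p i \<le> slack p j"
  using assms(3,2)
proof (induction j rule: dec_induct)
  case (step n)
  then show ?case using slack_step[OF assms(1), of n] by simp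
qed simp

lemma slack_nonneg: "alt p \<Longrightarrow> k < length p \<Longrightarrow> 0 \<le> slack p k"
  using slack_mono[of p k 0] slack_0 by simp

subsection \<open>Complementary slackness\<close>

text \<open>The defect stays zero as long as the path enters \<open>\<sigma>\<close>-classes only through their bases. Entering a
  class elsewhere adds one, and this can only be repaired by leaving through a base not visited
  before; otherwise the path is bad for good.\<close>

definition D :: "'a list \<Rightarrow> nat \<Rightarrow> nat \<Rightarrow> int" where
  "D p \<sigma> k = of_bool (odd k \<and> tn (p ! k) \<le> enat \<sigma>) - K p \<sigma> k"

text \<open>The path entered the current class from its base, visited at an even position, and has
  stayed inside since.\<close>

definition good :: "'a list \<Rightarrow> nat \<Rightarrow> nat \<Rightarrow> bool" where
  "good p \<sigma> k \<longleftrightarrow> (\<exists>j<k. even j \<and> p ! j = \<beta> \<sigma> (p ! k) \<and>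
     (\<forall>i. j < i \<and> i \<le> k \<longrightarrow> \<beta> \<sigma> (p ! i) = \<beta> \<sigma> (p ! k) \<and> tn (p ! i) \<le> enat \<sigma>))"

text \<open>Defects that cannot be repaired: stepping from the class to its base lowers the defect
  by one, and a simple path visits the base only once.\<close>

definition bad :: "'a list \<Rightarrow> nat \<Rightarrow> nat \<Rightarrow> bool" where
  "bad p \<sigma> k \<longleftrightarrow> (if tn (p ! k) \<le> enat \<sigma>
     then 2 \<le> D p \<sigma> k \<or> 1 \<le> D p \<sigma> k \<and> \<beta> \<sigma> (p ! k) \<in> set (take k p) else 1 \<le> D p \<sigma> k)"

lemma D_even:
  assumes "even k"
  shows "D p \<sigma> (Suc k) = D p \<sigma> k + of_bool (tn (p ! Suc k) \<le> enat \<sigma>)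
    - of_bool (\<beta> \<sigma> (p ! k) = \<beta> \<sigma> (p ! Suc k))"
  using assms by (simp add: D_def K_def)

text \<open>A matched edge inside a class lowers \<open>K\<close> by one exactly when the parity
  term of the defect disappears.\<close>

lemma D_odd:
  assumes "alt p" "Suc k < length p" "odd k" "\<sigma> \<in> S"
  shows "D p \<sigma> (Suc k) = D p \<sigma> k"
proof -
  have "{p ! k, p ! Suc k} \<in> M" using alt_matched[OF assms(1,2)] assms(3) by simp
  from matched_sim[OF assms(4) this] show ?thesis using assms(3) by (simp add: D_def K_def)
qed

lemma matched_step:
  assumes "alt p" "Suc k < length p" "odd k" "\<sigma> \<in> S"
  shows "tn (p ! Suc k) = tn (p ! k)" "tn (p ! k) \<le> enat \<sigma> \<Longrightarrow> \<beta> \<sigma> (p ! Suc k) = \<beta> \<sigma> (p ! k)"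
proof -
  have m: "{p ! k, p ! Suc k} \<in> M" using alt_matched[OF assms(1,2)] assms(3) by simp
  show "tn (p ! Suc k) = tn (p ! k)" using tn_mate[OF m] by simp
  show "tn (p ! k) \<le> enat \<sigma> \<Longrightarrow> \<beta> \<sigma> (p ! Suc k) = \<beta> \<sigma> (p ! k)"
    using matched_sim[OF assms(4) m] by simp
qed

lemma base_eq_self: "\<sigma> \<in> S \<Longrightarrow> \<not> tn u \<le> enat \<sigma> \<Longrightarrow> \<beta> \<sigma> u = u"
  using base_fixed[of \<sigma> u] by (simp add: S_def)

lemma good_Suc:
  assumes "good p \<sigma> k" "\<beta> \<sigma> (p ! Suc k) = \<beta> \<sigma> (p ! k)" "tn (p ! Suc k) \<le> enat \<sigma>"
  shows "good p \<sigma> (Suc k)"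
  using assms unfolding good_def by (metis le_SucE less_SucI)

lemma good_base_mem:
  assumes "good p \<sigma> k" "k < length p"
  shows "\<beta> \<sigma> (p ! k) \<in> set (take k p)"
proof -
  obtain j where "j < k" "p ! j = \<beta> \<sigma> (p ! k)" using assms(1) by (auto simp: good_def)
  then show ?thesis using assms(2) by (auto simp: in_set_conv_nth intro!: exI[of _ j])
qed

text \<open>Only a step from within a class to its base lowers the defect. At defect zero the class
  was entered from this base, and a simple path cannot return to it.\<close>

lemma D_invariant:
  assumes "alt p" "k < length p" "\<sigma> \<in> S"
  shows "0 \<le> D p \<sigma> k \<and> (D p \<sigma> k = 0 \<and> tn (p ! k) \<le> enat \<sigma> \<longrightarrow> good p \<sigma> k)"
  using assms(2)
proof (induction k)
  case 0
  have "enat T < tn (p ! 0)" using tn_free alt_nth_0[OF assms(1)] by blast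
  moreover have "\<sigma> < T" using assms(3) by (simp add: S_def)
  ultimately have "\<not> tn (p ! 0) \<le> enat \<sigma>" by (metis enat_ord_simps(2) leD order_less_trans)
  then show ?case by (simp add: D_def K_def)
next
  case (Suc k)
  let ?x = "p ! k" and ?y = "p ! Suc k"
  have IH: "0 \<le> D p \<sigma> k" "D p \<sigma> k = 0 \<Longrightarrow> tn ?x \<le> enat \<sigma> \<Longrightarrow> good p \<sigma> k"
    using Suc by auto
  have ne: "?x \<noteq> ?y" using alt_edge[OF assms(1) Suc.prems] edge_subset by blast
  show ?case
  proof (cases "even k")
    case False
    then show ?thesis
      using IH D_odd[OF assms(1) Suc.prems _ assms(3)] matched_step[OF assms(1) Suc.prems _ assms(3)]
        good_Suc[of p \<sigma> k] by auto
  next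
    case True
    note st = D_even[OF True, of p \<sigma>]
    show ?thesis
    proof (cases "\<beta> \<sigma> ?x = \<beta> \<sigma> ?y")
      case False
      then show ?thesis using st IH by auto
    next
      case sim: True
      show ?thesis
      proof (cases "tn ?y \<le> enat \<sigma>")
        case y: True
        have "good p \<sigma> (Suc k)" if "D p \<sigma> k = 0"
        proof (cases "tn ?x \<le> enat \<sigma>")
          case True
          then show ?thesis using IH(2)[OF that] sim y by (intro good_Suc) auto
        next
          case F: False
          then have "\<beta> \<sigma> ?x = ?x" using base_eq_self[OF assms(3)] by simp
          then show ?thesis unfolding good_def using True sim y
            by (intro exI[of _ k]) (auto simp: le_Suc_eq)
        qed
        then show ?thesis using st IH sim y by auto
      next
        case y: False
        then have y': "\<beta> \<sigma> ?y = ?y" using base_eq_self[OF assms(3)] by simp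
        have x: "tn ?x \<le> enat \<sigma>" using base_eq_self[OF assms(3), of ?x] sim y' ne by auto
        have "D p \<sigma> k \<noteq> 0"
        proof
          assume "D p \<sigma> k = 0"
          then have "?y \<in> set (take k p)"
            using good_base_mem[OF IH(2)[OF _ x]] Suc.prems sim y' by auto
          then show False using nth_notin_take[OF alt_distinct[OF assms(1)] Suc.prems, of k] by simp
        qed
        then show ?thesis using st IH sim y by auto
      qed
    qed
  qed
qed

lemma D_nonneg: "alt p \<Longrightarrow> k < length p \<Longrightarrow> \<sigma> \<in> S \<Longrightarrow> 0 \<le> D p \<sigma> k"
  and D_0_good: "alt p \<Longrightarrow> k < length p \<Longrightarrow> \<sigma> \<in> S \<Longrightarrow> D p \<sigma> k = 0 \<Longrightarrow> tn (p ! k) \<le> enat \<sigma> \<Longrightarrow> good p \<sigma> k"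
  using D_invariant by blast+

lemma bad_step:
  assumes "alt p" "Suc k < length p" "\<sigma> \<in> S" "bad p \<sigma> k"
  shows "bad p \<sigma> (Suc k)"
proof -
  let ?x = "p ! k" and ?y = "p ! Suc k"
  have ne: "?x \<noteq> ?y" using alt_edge[OF assms(1,2)] edge_subset by blast
  have D1: "1 \<le> D p \<sigma> k" using assms(4) by (auto simp: bad_def split: if_splits)
  show ?thesis
  proof (cases "even k")
    case False
    then show ?thesis
      using assms(4) D_odd[OF assms(1,2) _ assms(3)] matched_step[OF assms(1,2) _ assms(3)] take_Suc_mem[of _ k p]
      unfolding bad_def by (auto split: if_splits)
  next
    case True
    note st = D_even[OF True, of p \<sigma>]
    show ?thesis
    proof (cases "\<beta> \<sigma> ?x = \<beta> \<sigma> ?y")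
      case False
      then show ?thesis using st D1 by (auto simp: bad_def)
    next
      case sim: True
      show ?thesis
      proof (cases "tn ?y \<le> enat \<sigma>")
        case y: True
        show ?thesis
        proof (cases "tn ?x \<le> enat \<sigma>")
          case True
          then show ?thesis using assms(4) st sim y take_Suc_mem[of "\<beta> \<sigma> ?y" k p]
            by (auto simp: bad_def)
        next
          \<comment> \<open>Entering the class from its base leaves the defect unchanged but uses up
            the base, so it can no longer serve as an exit.\<close>
          case False
          then have "\<beta> \<sigma> ?y = ?x" using base_eq_self[OF assms(3)] sim by simp
          moreover have "?x \<in> set (take (Suc k) p)"
            using assms(2) by (auto simp: take_Suc_conv_app_nth)
          ultimately show ?thesis using D1 st sim y by (auto simp: bad_def)
        qed
      next
        case y: False
        then have y': "\<beta> \<sigma> ?y = ?y" using base_eq_self[OF assms(3)] by simp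
        have x: "tn ?x \<le> enat \<sigma>" using base_eq_self[OF assms(3), of ?x] sim y' ne by auto
        \<comment> \<open>The base is visited for the first time, so badness means defect at least
          two, and one unit remains after the exit.\<close>
        have "?y \<notin> set (take k p)"
          using nth_notin_take[OF alt_distinct[OF assms(1)] assms(2), of k] by simp
        then have "2 \<le> D p \<sigma> k" using assms(4) x sim y' by (auto simp: bad_def)
        then show ?thesis using st sim y by (auto simp: bad_def)
      qed
    qed
  qed
qed

section \<open>Paths attaining the dual bound\<close>

definition tight :: "'a list \<Rightarrow> bool" where
  "tight p \<longleftrightarrow> alt p \<and> slack p (path_length p) = 0 \<and> (\<forall>\<sigma>\<in>S. D p \<sigma> (path_length p) = 0)"

lemma tight_not_bad:
  assumes "tight p" "k < length p" "\<sigma> \<in> S"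
  shows "\<not> bad p \<sigma> k"
proof
  assume b: "bad p \<sigma> k"
  have p: "alt p" using assms by (simp add: tight_def)
  have len: "length p = Suc (path_length p)" using length_path_length alt_Nil[OF p] by blast
  have "k \<le> path_length p" using assms(2) len by simp
  then have "bad p \<sigma> (path_length p)"
  proof (induction rule: dec_induct)
    case base
    show ?case by (rule b)
  next
    case (step n)
    then show ?case using bad_step[OF p _ assms(3), of n] len by simp
  qed
  then have "1 \<le> D p \<sigma> (path_length p)" by (auto simp: bad_def split: if_splits)
  then show False using assms by (simp add: tight_def)
qed

text \<open>Slack is monotone and zero at the end, hence zero at \<open>k\<close>. A positive defect
  at a vertex above \<open>\<sigma>\<close> would be bad, so all terms \<open>K p \<sigma> k\<close>
  vanish and only the potential determines \<open>k\<close>.\<close>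

lemma tight_node_index:
  assumes "tight p" "k < length p" "enat T \<le> tn (p ! k)"
  shows "2 * int k = int T - (if even k then Y (p ! k) else - Y (p ! k))"
proof -
  have p: "alt p" using assms by (simp add: tight_def)
  have len: "length p = Suc (path_length p)" using length_path_length alt_Nil[OF p] by blast
  have "slack p k \<le> slack p (path_length p)" using slack_mono[OF p] assms(2) len by simp
  then have sl: "slack p k = 0" using slack_nonneg[OF p assms(2)] assms(1) by (simp add: tight_def)
  have "K p \<sigma> k = 0" if "\<sigma> \<in> S" for \<sigma>
  proof -
    have "enat \<sigma> < tn (p ! k)" using less_le_trans[OF _ assms(3), of "enat \<sigma>"] that by (simp add: S_def)
    then have a: "\<not> tn (p ! k) \<le> enat \<sigma>" by simp
    then have "\<not> 1 \<le> D p \<sigma> k" using tight_not_bad[OF assms(1,2) that] by (simp add: bad_def)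
    then have "D p \<sigma> k = 0" using D_nonneg[OF p assms(2) that] by simp
    then show ?thesis using a by (simp add: D_def)
  qed
  then have "(\<Sum>\<sigma>\<in>S. K p \<sigma> k) = 0" by simp
  then show ?thesis using sl by (auto simp: slack_def)
qed

lemma tight_last_good:
  assumes "tight p" "tn (last p) \<le> enat \<sigma>" "\<sigma> \<in> S"
  shows "good p \<sigma> (path_length p)"
proof -
  have p: "alt p" using assms by (simp add: tight_def)
  have len: "length p = Suc (path_length p)" using length_path_length alt_Nil[OF p] by blast
  then show ?thesis using assms D_0_good[OF p, of "path_length p" \<sigma>] last_nth_path_length[OF alt_Nil[OF p]]
    by (simp add: tight_def)
qed

text \<open>Defect zero means a good entry. Defect one must be repaired later, and the only repair
  is an unmatched step to the base, which puts the base at an odd position.\<close>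

lemma tight_base_cases:
  assumes "tight p" "k < length p" "tn (p ! k) \<le> enat \<sigma>" "\<sigma> \<in> S"
  obtains "good p \<sigma> k" | j where "k < j" "j < length p" "odd j" "p ! j = \<beta> \<sigma> (p ! k)"
proof -
  have p: "alt p" using assms by (simp add: tight_def)
  have len: "length p = Suc (path_length p)" using length_path_length alt_Nil[OF p] by blast
  have *: "\<exists>j>k. j < length p \<and> odd j \<and> p ! j = \<beta> \<sigma> (p ! k)"
    if "D p \<sigma> k = 1" "k < length p" "tn (p ! k) \<le> enat \<sigma>" for k
    using that
  proof (induction "path_length p - k" arbitrary: k)
    case 0
    then have "k = path_length p" using len by simp
    then show ?case using assms(1,4) 0 by (simp add: tight_def)
  next
    case (Suc m)
    let ?x = "p ! k" and ?y = "p ! Suc k"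
    have lt: "Suc k < length p" using Suc.hyps(2) len by simp
    have ne: "?x \<noteq> ?y" using alt_edge[OF p lt] edge_subset by blast
    have m: "m = path_length p - Suc k" using Suc.hyps(2) by simp
    have nb: "\<not> bad p \<sigma> (Suc k)" using tight_not_bad[OF assms(1) lt assms(4)] .
    have rec: ?case if "D p \<sigma> (Suc k) = 1" "tn ?y \<le> enat \<sigma>" "\<beta> \<sigma> ?y = \<beta> \<sigma> ?x"
      using Suc.hyps(1)[OF m that(1) lt that(2)] that(3) by (metis Suc_lessD)
    show ?case
    proof (cases "even k")
      case False
      then show ?thesis
        using Suc.prems D_odd[OF p lt _ assms(4)] matched_step[OF p lt _ assms(4)] by (intro rec) auto
    next
      case True
      note st = D_even[OF True, of p \<sigma>]
      show ?thesis
      proof (cases "\<beta> \<sigma> ?x = \<beta> \<sigma> ?y")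
        case False
        then show ?thesis using nb st Suc.prems by (auto simp: bad_def split: if_splits)
      next
        case sim: True
        show ?thesis
        proof (cases "tn ?y \<le> enat \<sigma>")
          case y: True
          then show ?thesis using st sim Suc.prems by (intro rec) auto
        next
          case y: False
          then have "\<beta> \<sigma> ?y = ?y" using base_eq_self[OF assms(4)] by simp
          then show ?thesis using sim True lt by (intro exI[of _ "Suc k"]) auto
        qed
      qed
    qed
  qed
  have "\<not> 2 \<le> D p \<sigma> k" using tight_not_bad[OF assms(1,2,4)] assms(3) by (auto simp: bad_def)
  then consider "D p \<sigma> k = 0" | "D p \<sigma> k = 1" using D_nonneg[OF p assms(2,4)] by linarith
  then show thesis
    using that * assms(2,3) D_0_good[OF p assms(2,4)] by cases blast+
qed

text \<open>The assumed expression equals the slack plus four times the sum of the defects at the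
  end of \<open>p\<close>; all these are nonnegative, so they vanish.\<close>

lemma tightI:
  assumes "alt p" and "2 * int (path_length p) - int T
      + (if even (path_length p) then Y (last p)
         else 4 * (\<Sum>\<sigma>\<in>S. of_bool (tn (last p) \<le> enat \<sigma>)) - Y (last p)) \<le> 0"
  shows "tight p"
proof -
  let ?n = "path_length p"
  have len: "?n < length p" using length_path_length[OF alt_Nil[OF assms(1)]] by simp
  have last: "last p = p ! ?n" using last_nth_path_length[OF alt_Nil[OF assms(1)]] .
  have D: "0 \<le> D p \<sigma> ?n" if "\<sigma> \<in> S" for \<sigma> using D_nonneg[OF assms(1) len that] .
  have "(\<Sum>\<sigma>\<in>S. K p \<sigma> ?n) = (\<Sum>\<sigma>\<in>S. of_bool (odd ?n \<and> tn (p ! ?n) \<le> enat \<sigma>)) - (\<Sum>\<sigma>\<in>S. D p \<sigma> ?n)"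
    unfolding D_def sum_subtractf by simp
  then have "slack p ?n + 4 * (\<Sum>\<sigma>\<in>S. D p \<sigma> ?n) \<le> 0"
    using assms(2) last by (auto simp: slack_def split: if_splits)
  moreover have "0 \<le> slack p ?n" by (rule slack_nonneg[OF assms(1) len])
  moreover have "0 \<le> (\<Sum>\<sigma>\<in>S. D p \<sigma> ?n)" using D by (rule sum_nonneg)
  ultimately have "slack p ?n = 0" "(\<Sum>\<sigma>\<in>S. D p \<sigma> ?n) = 0" by linarith+
  then show ?thesis using assms(1) D finite_S by (auto simp: tight_def sum_nonneg_eq_0_iff)
qed

lemma level_path_tight:
  assumes "level_path w p" "tn w \<le> enat T"
  shows "tight p"
proof -
  have p: "alt p" "last p = w" using assms by (auto simp: level_path_def)
  obtain a b where ab: "ev w = enat a" "od w = enat b" "even a" "odd b" "tn w = enat (a + b)" "a + b \<le> T"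
    using assms(2) by (rule tn_finiteD)
  have len: "path_length p = (if even (path_length p) then a else b)"
    using assms ab by (auto simp: level_path_def lvl_def)
  have sum: "2 * (\<Sum>\<sigma>\<in>S. of_bool (tn w \<le> enat \<sigma>)) = int T - int (a + b)"
    using ab by (intro sum_tn_less) auto
  have "Y w = int T - 2 * int a \<or> a + b = T \<and> Y w = 2 * int b - int T"
  proof (cases w rule: Y_cases)
    \<comment> \<open>The default value cannot occur: both levels would exceed their thresholds,
      giving a tenacity above \<open>T\<close>.\<close>
    case N
    then have "(T + 1) div 2 < a" "(T - 1) div 2 < b" using ab by auto
    then show ?thesis using \<open>a + b \<le> T\<close> odd_T by presburger
  qed (use ab in auto)
  then show ?thesis using len sum p by (intro tightI) (auto split: if_splits)
qed

text \<open>Needs no bound on the tenacity of \<open>w\<close>; this serves an edge of tenacity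
  \<open>T\<close> one of whose ends has larger tenacity.\<close>

lemma even_level_path_tight:
  assumes "level_path w p" "even (path_length p)" "ev w \<le> enat ((T + 1) div 2)"
  shows "tight p"
proof -
  have p: "alt p" "last p = w" "ev w = enat (path_length p)"
    using assms by (auto simp: level_path_def lvl_def)
  then have "Y w = int T - 2 * int (path_length p)" using assms by (simp add: Y_def)
  then show ?thesis using assms p by (intro tightI) auto
qed

text \<open>At tenacity \<open>T\<close> the two positions allowed by the potential are the
  evenlevel and the oddlevel themselves.\<close>

lemma tight_node_level:
  assumes "tight p" "k < length p" "tn (p ! k) = enat T"
  shows "level_path (p ! k) (take (Suc k) p)"
proof -
  have p: "alt p" using assms by (simp add: tight_def)
  obtain a b where ab: "ev (p ! k) = enat a" "od (p ! k) = enat b" "even a" "odd b" "tn (p ! k) = enat (a + b)"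
    using tn_finiteD[of "p ! k" T] assms(3) by (metis order_refl)
  have T: "T = a + b" using ab assms(3) by simp
  have "Y (p ! k) = int T - 2 * int a"
    by (cases "p ! k" rule: Y_cases) (use ab T in auto)
  then have "enat k = lvl k (p ! k)"
    using tight_node_index[OF assms(1,2)] assms(3) ab T by (auto simp: lvl_def split: if_splits)
  then show ?thesis using alt_take[OF p assms(2)] by (simp add: level_path_def)
qed

subsection \<open>Edges of tenacity T\<close>

text \<open>For a matched edge both paths are odd, since \<open>oddlevel u + oddlevel v + 1\<close> is the tenacity of its ends.\<close>

definition closing :: "'a \<Rightarrow> 'a \<Rightarrow> 'a list \<Rightarrow> 'a list \<Rightarrow> bool" where
  "closing u v p q \<longleftrightarrow> level_path u p \<and> level_path v q \<and> {u, v} \<in> E \<and>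
     even (path_length p) = even (path_length q) \<and> ({u, v} \<in> M) = odd (path_length p) \<and>
     path_length p + path_length q + 1 = T"

lemma closing_sym: "closing u v p q \<Longrightarrow> closing v u q p"
  by (auto simp: closing_def insert_commute)

lemma closing_odd_tn:
  assumes "closing u v p q" "odd (path_length p)"
  shows "tn u = enat T"
proof -
  have "{u, v} \<in> M" "od u = enat (path_length p)" "od v = enat (path_length q)"
    using assms by (auto simp: closing_def level_path_def lvl_def)
  then have "tn u = enat (path_length p) + enat (path_length q) + 1" using tn_mate(2)[of u v] by simp
  also have "\<dots> = enat T" using assms by (simp add: closing_def one_enat_def)
  finally show ?thesis .
qed

text \<open>If \<open>u\<close> has tenacity above \<open>T\<close>, the edge is unmatched and the
  oddlevel of \<open>u\<close> exceeds \<open>ev v + 1\<close>. Then \<open>ev u \<le> ev v\<close>,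
  so \<open>p\<close> is the shorter path and its length is below
  \<open>(T + 1) / 2\<close>.\<close>

lemma closing_tight:
  assumes "closing u v p q"
  shows "tight p"
proof (cases "tn u \<le> enat T")
  case True
  then show ?thesis using level_path_tight assms by (auto simp: closing_def)
next
  case False
  then have even: "even (path_length p)" using closing_odd_tn[OF assms] by (metis order_refl)
  have lev: "ev u = enat (path_length p)" "ev v = enat (path_length q)"
    using assms even by (auto simp: closing_def level_path_def lvl_def)
  have T: "path_length p + path_length q + 1 = T" using assms by (simp add: closing_def)
  have "od u \<le> ev v + 1 \<or> ev u \<le> ev v"
    using assms even by (intro unmatched_edge_levels) (auto simp: closing_def)
  moreover have "\<not> od u \<le> ev v + 1"
  proof
    assume "od u \<le> ev v + 1"
    then have "tn u \<le> ev u + (ev v + 1)" unfolding tenacity_def by (rule add_left_mono)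
    also have "\<dots> = enat T" using lev T by (simp add: one_enat_def)
    finally show False using False by simp
  qed
  ultimately have "path_length p \<le> path_length q" using lev by simp
  then have "path_length p \<le> (T + 1) div 2" using T by linarith
  then show ?thesis using lev even assms by (intro even_level_path_tight[of u]) (auto simp: closing_def)
qed

text \<open>From an odd position the path continues with a matched edge, whose ends share their
  tenacity; at the very end, an odd position forces tenacity exactly \<open>T\<close>.\<close>

lemma closing_last_above_even:
  assumes "closing u v p q" "i < length p" "enat T < tn (p ! i)"
    "\<And>j. i < j \<Longrightarrow> j < length p \<Longrightarrow> tn (p ! j) \<le> enat T"
  shows "even i"
proof (rule ccontr)
  assume odd: "odd i"
  have p: "alt p" "last p = u" using assms by (auto simp: closing_def level_path_def)
  have len: "length p = Suc (path_length p)" "last p = p ! path_length p"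
    using alt_Nil[OF p(1)] by (auto simp: length_path_length last_nth_path_length)
  show False
  proof (cases "i = path_length p")
    case True
    then show False using closing_odd_tn[OF assms(1)] odd p len assms(3) by simp
  next
    case False
    then have lt: "Suc i < length p" using assms(2) len by simp
    then have "{p ! i, p ! Suc i} \<in> M" using alt_matched[OF p(1)] odd by blast
    then have "tn (p ! i) = tn (p ! Suc i)" by (rule tn_mate)
    then show False using assms(3) assms(4)[OF _ lt] by simp
  qed
qed

lemma tight_common_node:
  assumes "tight p" "tight q" "i < length p" "j < length q" "i + j < T" "p ! i = q ! j" "enat T \<le> tn (p ! i)"
  shows "i = j"
  using tight_node_index[OF assms(1,3)] tight_node_index[OF assms(2,4)] assms(5-7)
  by (auto split: if_splits)

text \<open>Both paths are reduced to odd paths ending at \<open>w\<close> or its mate, and the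
  matched edge between these two is closing. \<open>N\<close> is the induction measure; the reduced
  paths are shorter than \<open>N\<close>.\<close>

lemma node_base_unique:
  assumes hyp: "\<And>u v p q b c. closing u v p q \<Longrightarrow> min (path_length p) (path_length q) < N \<Longrightarrow>
      last_above T p b \<Longrightarrow> last_above T q c \<Longrightarrow> b = c"
    and w: "tn w = enat T" "w \<in> V" and p: "level_path w p" "last_above T p b" and q: "level_path w q" "last_above T q c"
    and N: "path_length p \<le> N" "path_length q \<le> N" "odd (path_length p) \<Longrightarrow> path_length p < N"
      "odd (path_length q) \<Longrightarrow> path_length q < N"
  shows "b = c"
proof -
  obtain w' where w': "{w, w'} \<in> M" using tn_finite_mate[of w] w T_less by auto
  have w'': "{w', w} \<in> M" using w' by (simp add: insert_commute)
  have tw': "tn w' = enat T" using tn_mate(1)[OF w'] w by simp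
  obtain u1 p' where p': "u1 = w \<or> u1 = w'" "level_path u1 p'" "odd (path_length p')" "last_above T p' b"
    "path_length p' < N"
    using level_path_reduce[OF p(1) w' _ p(2)] w N by (metis le_less_trans less_le_trans order_refl)
  obtain u2 q' where q': "u2 = w \<or> u2 = w'" "level_path u2 q'" "odd (path_length q')" "last_above T q' c"
    "path_length q' < N"
    using level_path_reduce[OF q(1) w' _ q(2)] w N by (metis le_less_trans less_le_trans order_refl)
  have closingI: "closing x y r s" if "{x, y} \<in> M" "tn x = enat T" "level_path x r" "odd (path_length r)"
    "level_path y s" "odd (path_length s)" for x y r s
  proof -
    have "od x = enat (path_length r)" "od y = enat (path_length s)"
      using that by (auto simp: level_path_def lvl_def)
    then have "path_length r + path_length s + 1 = T" using tn_mate(2)[OF that(1)] that(2) by (simp add: one_enat_def)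
    then show ?thesis using that matching_subset[OF that(1)] by (simp add: closing_def)
  qed
  show ?thesis
  proof (cases "u1 = u2")
    case False
    then have "{u1, u2} \<in> M" "tn u1 = enat T" using p'(1) q'(1) w' w'' tw' w by auto
    then have "closing u1 u2 p' q'" using p' q' by (intro closingI)
    then show ?thesis using hyp[of u1 u2 p' q'] p' q' by simp
  next
    \<comment> \<open>Both reduced paths end at the same vertex, so each is compared with one odd
      level path to its mate.\<close>
    case True
    obtain x where x: "{u1, x} \<in> M" "tn u1 = enat T" "tn x = enat T" using p'(1) w' w'' tw' w by metis
    have "od x \<noteq> \<infinity>" using x(3) by (cases "ev x"; cases "od x"; simp add: tenacity_def)
    then obtain r where r: "level_path x r" "odd (path_length r)" by (metis od_attained)
    then have "alt r" by (simp add: level_path_def)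
    then obtain d where d: "last_above T r d" using last_above_exists T_less by blast
    have "closing u1 x p' r" "closing u1 x q' r" using closingI x p' q' r True by auto
    then show ?thesis using hyp[of u1 x p' r b d] hyp[of u1 x q' r c d] p' q' d by simp
  qed
qed

lemma tn_less_S:
  assumes "tn z < enat T"
  shows "T - 2 \<in> S" "tn z \<le> enat (T - 2)"
  using tn_le_pred[OF assms odd_T] by (auto simp: S_def)

lemma base_ge:
  assumes "T - 2 \<in> S"
  shows "enat T \<le> tn (\<beta> (T - 2) z)"
proof (rule ccontr)
  assume "\<not> ?thesis"
  then have "tn (\<beta> (T - 2) z) \<le> enat (T - 2)" using tn_le_pred odd_T by simp
  then show False using base_tn[of "T - 2" z] assms by (simp add: S_def)
qed

text \<open>\<open>T - 2\<close> is the largest odd number below \<open>T\<close>, and a level path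
  to \<open>z\<close> is tight, so its end is good in that layer.\<close>

lemma base_on_path:
  assumes "level_path z p" "tn z < enat T"
  obtains j where "j < path_length p" "even j" "p ! j = \<beta> (T - 2) z" "tight p"
    "\<And>i. j < i \<Longrightarrow> i < length p \<Longrightarrow> tn (p ! i) < enat T"
proof -
  have p: "alt p" "last p = z" using assms by (auto simp: level_path_def)
  have len: "length p = Suc (path_length p)" "last p = p ! path_length p"
    using alt_Nil[OF p(1)] by (auto simp: length_path_length last_nth_path_length)
  note S = tn_less_S[OF assms(2)]
  have t: "tight p" using level_path_tight assms by simp
  then have "good p (T - 2) (path_length p)" using tight_last_good S p by simp
  then obtain j where j: "j < path_length p" "even j" "p ! j = \<beta> (T - 2) z"
    "\<And>i. j < i \<Longrightarrow> i \<le> path_length p \<Longrightarrow> tn (p ! i) \<le> enat (T - 2)"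
    unfolding good_def using p len by auto
  moreover have "enat (T - 2) < enat T" using S by (simp add: S_def)
  ultimately show thesis using that[OF j(1-3) t] len by (metis le_less_trans less_Suc_eq_le)
qed

text \<open>\<open>hyp\<close> covers edges whose shorter path is shorter than \<open>p\<close>. By
  \<open>le\<close> every position on \<open>p\<close> is below \<open>T / 2\<close>, which makes
  complementary positions impossible.\<close>

lemma closing_base_aux:
  assumes hyp: "\<And>u' v' p' q' b' c'. closing u' v' p' q' \<Longrightarrow> min (path_length p') (path_length q') < path_length p \<Longrightarrow>
      last_above T p' b' \<Longrightarrow> last_above T q' c' \<Longrightarrow> b' = c'"
    and cl: "closing u v p q" and le: "path_length p \<le> path_length q"
    and b: "last_above T p b" and x: "last_above T q x"
  shows "b = x"
proof -
  define n where "n = path_length p"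
  define m where "m = path_length q"
  have lp: "level_path u p" and lq: "level_path v q" and T: "n + m + 1 = T" and uvE: "{u, v} \<in> E"
    and par: "even n = even m" and uvM: "({u, v} \<in> M) = odd n"
    using cl by (auto simp: closing_def n_def m_def)
  have p: "alt p" "last p = u" and q: "alt q" "last q = v" using lp lq by (auto simp: level_path_def)
  have len: "length p = Suc n" "last p = p ! n" "length q = Suc m" "last q = q ! m"
    using alt_Nil[OF p(1)] alt_Nil[OF q(1)]
    by (auto simp: length_path_length last_nth_path_length n_def m_def)
  have tp: "tight p" by (rule closing_tight[OF cl])
  have tq: "tight q" by (rule closing_tight[OF closing_sym[OF cl]])
  note dp = nth_eq_iff_index_eq[OF alt_distinct[OF p(1)]]
  note dq = nth_eq_iff_index_eq[OF alt_distinct[OF q(1)]]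
  have common: "i = j" if "i < length p" "j < length q" "p ! i = q ! j" "enat T \<le> tn (p ! i)" for i j
    using tight_common_node[OF tp tq that(1,2) _ that(3,4)] that(1,2) len T by simp
  obtain i where i: "i < length p" "p ! i = b" "enat T < tn b"
    and i_max: "\<And>j. i < j \<Longrightarrow> j < length p \<Longrightarrow> tn (p ! j) \<le> enat T"
    using b unfolding last_above_def by blast
  have i_even: "even i" using closing_last_above_even[OF cl i(1)] i i_max by blast
  obtain k where k: "k < length q" "q ! k = x" "enat T < tn x"
    and k_max: "\<And>j. k < j \<Longrightarrow> j < length q \<Longrightarrow> tn (q ! j) \<le> enat T"
    using x unfolding last_above_def by blast
  have k_even: "even k" using closing_last_above_even[OF closing_sym[OF cl] k(1)] k k_max by blast
  have vu: "{last q, last p} \<in> E" "({last q, last p} \<in> M) = odd (path_length q)"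
    using uvE uvM par p q by (auto simp: insert_commute m_def)
  have "set q \<inter> set (drop i p) \<noteq> {}"
  proof
    assume "set q \<inter> set (drop i p) = {}"
    from join_paths[OF p(1) q(1) vu _ i(1) i_even this]
    have "tn b \<le> enat T" using par i T by (simp add: tenacity_def n_def m_def)
    then show False using i by simp
  qed
  then obtain z where z: "z \<in> set q" "z \<in> set (drop i p)" by blast
  let ?A = "{j. i \<le> j \<and> j < length p \<and> p ! j \<in> set q}"
  obtain l where "l < length (drop i p)" "drop i p ! l = z" using z(2) by (auto simp: in_set_conv_nth)
  then have "i + l \<in> ?A" using z(1) i by auto
  then have "?A \<noteq> {}" by blast
  have finA: "finite ?A" by simp
  define e where "e = Max ?A"
  have "e \<in> ?A" unfolding e_def by (rule Max_in[OF finA \<open>?A \<noteq> {}\<close>])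
  then have e: "i \<le> e" "e < length p" "p ! e \<in> set q" by auto
  have e_max: "j \<le> e" if "j < length p" "p ! j \<in> set q" "i \<le> j" for j
    unfolding e_def using that by (intro Max_ge finA) auto
  obtain f where f: "f < length q" "q ! f = p ! e" using e(3) by (auto simp: in_set_conv_nth)
  \<comment> \<open>\<open>c\<close> is the common position of the last shared vertex of large
    tenacity: \<open>e\<close> itself, or the base of the class of \<open>p ! e\<close>. Whatever
    \<open>p\<close> shares with \<open>q\<close> after it lies on \<open>q\<close> in a stretch of
    small tenacity following \<open>c\<close>.\<close>
  have "\<exists>c. i \<le> c \<and> c \<le> e \<and> c < length q \<and> q ! c = p ! c \<and> enat T \<le> tn (p ! c) \<and>
    (\<forall>j l. c < j \<and> j \<le> e \<and> l < length q \<and> q ! l = p ! j \<longrightarrow>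
       c < l \<and> (\<forall>h. c < h \<and> h \<le> l \<longrightarrow> tn (q ! h) < enat T))"
  proof (cases "enat T \<le> tn (p ! e)")
    case True
    then have "f = e" using common[of e f] e f by simp
    then show ?thesis using e f True by (intro exI[of _ e]) auto
  next
    case False
    define z where "z = p ! e"
    have tz: "tn z < enat T" using False by (simp add: z_def)
    define \<sigma> where "\<sigma> = T - 2"
    have S: "\<sigma> \<in> S" "tn z \<le> enat \<sigma>" using tn_less_S[OF tz] by (auto simp: \<sigma>_def)
    have \<sigma>T: "enat \<sigma> < enat T" using S by (simp add: S_def)
    define n0 where "n0 = \<beta> \<sigma> z"
    have n0: "enat T \<le> tn n0" using base_ge S by (simp add: n0_def \<sigma>_def)
    have "good p \<sigma> e"
    proof (rule tight_base_cases[OF tp e(2) _ S(1)])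
      show "tn (p ! e) \<le> enat \<sigma>" using S by (simp add: z_def)
      fix j assume j: "e < j" "j < length p" "odd j" "p ! j = \<beta> \<sigma> (p ! e)"
      obtain a' b' where ab: "ev z = enat a'" "od z = enat b'" "tn z = enat (a' + b')" "a' + b' \<le> \<sigma>"
        using tn_finiteD[OF S(2)] by metis
      obtain r where r: "level_path z r" "path_length r = a'" using ev_attained[of z] ab by (metis enat.distinct(1) enat.inject)
      obtain s where s: "level_path z s" "path_length s = b'" using od_attained[of z] ab by (metis enat.distinct(1) enat.inject)
      \<comment> \<open>The shorter of the two level paths to \<open>z\<close> has the base at an
        even position \<open>g\<close> below \<open>T / 2\<close>. On \<open>p\<close> the base
        would be at the complementary position \<open>j\<close>, also below \<open>T / 2\<close>,
        contradicting \<open>j + g = T\<close>.\<close>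
      obtain t where t: "level_path z t" "2 * path_length t \<le> \<sigma>" using r s ab(4) by (metis add_le_mono le_trans mult_2 nat_le_linear)
      obtain g where g: "g < path_length t" "even g" "t ! g = \<beta> (T - 2) z" "tight t"
        using base_on_path[OF t(1) tz] by blast
      have gl: "g < length t" using g(1) by (simp add: path_length_def)
      have pj: "p ! j = n0" using j by (simp add: n0_def z_def)
      have tg: "t ! g = n0" using g(3) by (simp add: n0_def \<sigma>_def)
      have "2 * int j = int T + Y n0" using tight_node_index[OF tp j(2)] pj n0 j(3) by simp
      moreover have "2 * int g = int T - Y n0" using tight_node_index[OF g(4) gl] tg n0 g(2) by simp
      ultimately have "j + g = T" by linarith
      moreover have "2 * g < T" using g(1) t(2) \<sigma>T by simp
      moreover have "2 * j < T" using j(2) len T le by (simp add: n_def m_def)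
      ultimately show ?thesis by linarith
    qed
    then obtain c where c: "c < e" "even c" "p ! c = n0"
      "\<And>h. c < h \<Longrightarrow> h \<le> e \<Longrightarrow> \<beta> \<sigma> (p ! h) = n0 \<and> tn (p ! h) \<le> enat \<sigma>"
      unfolding good_def n0_def z_def by blast
    have cp: "c < length p" using c e by simp
    have ic: "i \<le> c"
    proof (rule ccontr)
      assume "\<not> i \<le> c"
      then have "tn b \<le> enat \<sigma>" using c(4)[of i] e i by simp
      then show False using i \<sigma>T by (metis leD less_le_trans less_imp_le)
    qed
    \<comment> \<open>On \<open>q\<close> the base of this class can only be at the even position
      \<open>c\<close>, so every vertex of the class on \<open>q\<close> was reached from
      it.\<close>
    have up: "\<exists>c'<l. q ! c' = n0 \<and> c' = c \<and> (\<forall>h. c' < h \<and> h \<le> l \<longrightarrow> tn (q ! h) \<le> enat \<sigma>)"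
      if l: "l < length q" "\<beta> \<sigma> (q ! l) = n0" "tn (q ! l) \<le> enat \<sigma>" for l
    proof (rule tight_base_cases[OF tq l(1,3) S(1)])
      assume "good q \<sigma> l"
      then obtain c' where c': "c' < l" "q ! c' = n0" "\<forall>h. c' < h \<and> h \<le> l \<longrightarrow> tn (q ! h) \<le> enat \<sigma>"
        unfolding good_def using l by auto
      then have "c = c'" using common[of c c'] cp c l n0 by simp
      then show ?thesis using c' by blast
    next
      fix j assume j: "l < j" "j < length q" "odd j" "q ! j = \<beta> \<sigma> (q ! l)"
      then have "c = j" using common[of c j] cp c l n0 by simp
      then show ?thesis using j c by simp
    qed
    have "q ! c = n0" "c < length q" using up[OF f(1)] f S by (auto simp: n0_def z_def)
    moreover have "c < l \<and> (\<forall>h. c < h \<and> h \<le> l \<longrightarrow> tn (q ! h) < enat T)"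
      if "c < j" "j \<le> e" "l < length q" "q ! l = p ! j" for j l
      using up[of l] c(4)[of j] that \<sigma>T by (metis le_less_trans)
    ultimately show ?thesis using ic c n0 by (intro exI[of _ c]) auto
  qed
  then obtain c where c: "i \<le> c" "c \<le> e" "c < length q" "q ! c = p ! c" "enat T \<le> tn (p ! c)"
    and c_sep: "\<And>j l h. \<lbrakk>c < j; j \<le> e; l < length q; q ! l = p ! j\<rbrakk> \<Longrightarrow> c < l"
    and c_low: "\<And>j l h. \<lbrakk>c < j; j \<le> e; l < length q; q ! l = p ! j; c < h; h \<le> l\<rbrakk> \<Longrightarrow> tn (q ! h) < enat T"
    by blast
  have cp: "c < length p" using c e by simp
  have meet: "c < l" "c < h \<Longrightarrow> h \<le> l \<Longrightarrow> tn (q ! h) < enat T"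
    if "c < j" "j < length p" "l < length q" "q ! l = p ! j" for j l h
  proof -
    have "j \<le> e" using e_max[of j] that c by (metis le_trans less_imp_le nth_mem)
    then show "c < l" "c < h \<Longrightarrow> h \<le> l \<Longrightarrow> tn (q ! h) < enat T" using c_sep c_low that by blast+
  qed
  have bq: "last_above T (take (Suc c) q) b"
  proof (cases "c = i")
    case True
    then show ?thesis using last_above_self[of "take (Suc c) q" T] alt_take[OF q(1) c(3)] i c alt_Nil by metis
  next
    case False
    then have tc: "tn (p ! c) = enat T" using i_max[of c] c cp by simp
    have l1: "level_path (p ! c) (take (Suc c) p)" by (rule tight_node_level[OF tp cp tc])
    have l2: "level_path (p ! c) (take (Suc c) q)" using tight_node_level[OF tq c(3)] c(4) tc by simp
    have a1: "last_above T (take (Suc c) p) b"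
      unfolding last_above_def using i i_max c cp by (intro exI[of _ i]) auto
    obtain b' where a2: "last_above T (take (Suc c) q) b'"
      using last_above_exists[OF alt_take(1)[OF q(1) c(3)] T_less] by blast
    have pl: "path_length (take (Suc c) p) = c" "path_length (take (Suc c) q) = c"
      using alt_take[OF p(1) cp] alt_take[OF q(1) c(3)] by auto
    \<comment> \<open>The induction hypothesis needs strict decrease for odd prefixes. For
      \<open>c = n\<close> odd the edge is matched and \<open>u\<close> lies on \<open>q\<close>,
      although the mate of the end of an odd path is never on it.\<close>
    have "c \<noteq> n" if "odd c"
    proof
      assume "c = n"
      then have "{u, last q} \<in> M" "odd (path_length q)" "u = q ! c"
        using that uvM par q p len c by (auto simp: m_def)
      then show False using mate_notin_odd_path[OF q(1)] c(3) by (metis nth_mem)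
    qed
    then have "odd c \<Longrightarrow> c < path_length p" "c \<le> path_length p" using cp len n_def by auto
    moreover have "p ! c \<in> V" using alt_set[OF p(1)] cp by auto
    ultimately have "b = b'"
      using node_base_unique[OF hyp tc _ l1 a1 l2 a2] pl by simp
    then show ?thesis using a2 by simp
  qed
  show ?thesis
  proof (cases "k \<le> c")
    case True
    have "last_above T (take (Suc c) q) x"
      unfolding last_above_def using k k_max c True by (intro exI[of _ k]) auto
    then show ?thesis using bq last_above_unique by blast
  next
    case False
    \<comment> \<open>The detour along \<open>q\<close> up to \<open>c\<close> and then along
      \<open>p\<close> to \<open>u\<close> has the length of \<open>p\<close> and avoids
      \<open>q\<close> from \<open>k\<close> on, so joining it with \<open>q\<close> bounds the
      tenacity of \<open>x\<close> by \<open>T\<close>.\<close>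
    define r where "r = take (Suc c) q @ drop (Suc c) p"
    have drop_mem: "\<exists>j. c < j \<and> j < length p \<and> y = p ! j" if y: "y \<in> set (drop (Suc c) p)" for y
    proof -
      obtain l where "l < length (drop (Suc c) p)" "drop (Suc c) p ! l = y" using y by (auto simp: in_set_conv_nth)
      then show ?thesis by (intro exI[of _ "Suc c + l"]) auto
    qed
    have "y \<notin> set (drop (Suc c) p)" if y: "y \<in> set (take (Suc c) q)" for y
    proof
      assume "y \<in> set (drop (Suc c) p)"
      then obtain j where j: "c < j" "j < length p" "y = p ! j" using drop_mem by blast
      obtain l where "l \<le> c" "l < length q" "q ! l = y"
        using y by (auto simp: in_set_conv_nth less_Suc_eq_le)
      then show False using meet(1)[OF j(1,2)] j by fastforce
    qed
    then have d1: "set (take (Suc c) q) \<inter> set (drop (Suc c) p) = {}" by blast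
    note r = splice_paths[OF p(1) q(1) cp c(3) c(4)[symmetric] d1, folded r_def]
    have "y \<notin> set (drop k q)" if y: "y \<in> set r" for y
    proof
      assume "y \<in> set (drop k q)"
      then obtain l where "l < length (drop k q)" "drop k q ! l = y" by (auto simp: in_set_conv_nth)
      then obtain l where l: "k \<le> l" "l < length q" "q ! l = y" using k(1) by (metis le_add1 length_drop less_diff_conv add.commute nth_drop less_imp_le)
      consider "y \<in> set (take (Suc c) q)" | "y \<in> set (drop (Suc c) p)" using y by (auto simp: r_def)
      then show False
      proof cases
        case 1
        then obtain g where "g \<le> c" "g < length q" "q ! g = y"
          by (auto simp: in_set_conv_nth less_Suc_eq_le)
        then show False using dq[of g l] l False by simp
      next
        case 2
        then obtain j where j: "c < j" "j < length p" "y = p ! j" using drop_mem by blast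
        have "tn (q ! k) < enat T" using meet(2)[OF j(1,2) l(2), of k] l j False by simp
        then show False using k by (metis less_asym)
      qed
    qed
    then have d2: "set r \<inter> set (drop k q) = {}" by blast
    have "{last r, last q} \<in> E" "({last r, last q} \<in> M) = odd (path_length r)"
      "even (path_length q) = even (path_length r)"
      using uvE uvM par p q r by (auto simp: n_def m_def)
    from join_paths[OF q(1) r(1) this k(1) k_even d2]
    have "tn x \<le> enat T" using k r T by (simp add: tenacity_def n_def m_def add.commute)
    then show ?thesis using k by simp
  qed
qed

lemma closing_base:
  assumes "closing u v p q" "last_above T p b" "last_above T q c"
  shows "b = c"
  using assms
proof (induction "min (path_length p) (path_length q)" arbitrary: u v p q b c rule: less_induct)
  case less
  show ?case
  proof (cases "path_length p \<le> path_length q")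
    case True
    then show ?thesis using less by (intro closing_base_aux[of p u v q b c]) (auto simp: min_def)
  next
    case False
    then have "c = b" using less closing_sym by (intro closing_base_aux[of q v u p c b]) (auto simp: min_def)
    then show ?thesis by simp
  qed
qed

text \<open>Beyond the \<open>T - 2\<close> base everything on \<open>p\<close> has tenacity below
  \<open>T\<close>, so only the prefix ending at that base matters; if the base has tenacity
  \<open>T\<close>, this prefix is a level path again.\<close>

lemma last_above_via_base:
  assumes "level_path w p" "last_above T p b" "tn w < enat T"
  shows "if enat T < tn (\<beta> (T - 2) w) then b = \<beta> (T - 2) w
    else tn (\<beta> (T - 2) w) = enat T \<and> (\<exists>q. level_path (\<beta> (T - 2) w) q \<and> last_above T q b)"
proof -
  obtain j where j: "j < path_length p" "p ! j = \<beta> (T - 2) w" "tight p"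
    "\<And>i. j < i \<Longrightarrow> i < length p \<Longrightarrow> tn (p ! i) < enat T"
    using base_on_path[OF assms(1,3)] by metis
  have jl: "j < length p" using j(1) by (simp add: path_length_def)
  have l: "last_above T (take (Suc j) p) b"
    using last_above_take[OF jl, of T b] j(4) assms(2) by (simp add: less_imp_le)
  have a: "alt p" using assms by (simp add: level_path_def)
  show ?thesis
  proof (cases "enat T < tn (\<beta> (T - 2) w)")
    case True
    then have "last_above T (take (Suc j) p) (\<beta> (T - 2) w)"
      using last_above_self[of "take (Suc j) p" T] alt_take[OF a jl] alt_Nil j(2) by metis
    then show ?thesis using last_above_unique[OF l] True by simp
  next
    case False
    then have "tn (\<beta> (T - 2) w) = enat T" using base_ge[OF tn_less_S(1)[OF assms(3)], of w] by simp
    moreover from this have "level_path (\<beta> (T - 2) w) (take (Suc j) p)"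
      using tight_node_level[OF j(3) jl] j(2) by simp
    ultimately show ?thesis using l False by auto
  qed
qed

lemma base_unique:
  assumes "level_path w p" "last_above T p b" "level_path w q" "last_above T q c" "tn w \<le> enat T"
  shows "b = c"
proof -
  \<comment> \<open>Edges of tenacity \<open>T\<close> are settled by now, so any \<open>N\<close>
    larger than both lengths will do.\<close>
  have node: "b' = c'" if "tn n = enat T" "level_path n p'" "last_above T p' b'" "level_path n q'" "last_above T q' c'"
    for n p' q' b' c'
    by (rule node_base_unique[where N = "path_length p' + path_length q' + 1",
          OF _ that(1) level_path_in_V[OF that(2)] that(2-5)])
      (auto intro: closing_base)
  show ?thesis
  proof (cases "tn w = enat T")
    case True
    then show ?thesis using node assms by blast
  next
    case False
    then have "tn w < enat T" using assms by simp
    then show ?thesis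
      using last_above_via_base[OF assms(1,2)] last_above_via_base[OF assms(3,4)] node
      by (auto split: if_splits)
  qed
qed

section \<open>The base function at \<open>T\<close>\<close>

lemma base_T_eq:
  assumes "level_path w p" "last_above T p b" "tn w \<le> enat T"
  shows "base T w = b"
proof -
  have "(SOME b. \<exists>p. level_path w p \<and> last_above T p b) = b"
    using assms base_unique by (intro some_equality) blast+
  then show ?thesis using assms by (simp add: base_def)
qed

lemma base_T_level_path:
  assumes "level_path w p" "last_above T p b"
  shows "base T w = b"
proof (cases "tn w \<le> enat T")
  case True
  then show ?thesis using base_T_eq assms by blast
next
  case False
  have "p \<noteq> []" "last p = w" using assms alt_Nil by (auto simp: level_path_def)
  then have "last_above T p w" using last_above_self[of p T] False by simp
  then show ?thesis using last_above_unique[OF assms(2)] False by (simp add: base_def)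
qed

lemma base_T_tn: "enat T < tn (base T w)"
proof (cases "tn w \<le> enat T")
  case True
  then obtain p where p: "level_path w p" by (rule level_path_exists)
  then have "alt p" by (simp add: level_path_def)
  then obtain b where b: "last_above T p b" using last_above_exists T_less by blast
  then have "enat T < tn b" by (auto simp: last_above_def)
  then show ?thesis using base_T_eq[OF p b True] by simp
qed (simp add: base_def)

text \<open>Classes of layer \<open>T\<close> are unions of classes of layer \<open>T - 2\<close>:
  level paths to a vertex below \<open>T\<close> run through its earlier base.\<close>

lemma base_T_base:
  assumes "3 \<le> T"
  shows "base T w = base T (\<beta> (T - 2) w)"
proof (cases "tn w < enat T")
  case True
  then have "tn w \<le> enat T" by simp
  then obtain p where p: "level_path w p" by (rule level_path_exists)
  then have "alt p" by (simp add: level_path_def)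
  then obtain b where b: "last_above T p b" using last_above_exists T_less by blast
  have "base T (\<beta> (T - 2) w) = b"
    using last_above_via_base[OF p b True] base_T_eq[of "\<beta> (T - 2) w" _ b] base_above[of T "\<beta> (T - 2) w"]
    by (auto split: if_splits)
  then show ?thesis using base_T_eq[OF p b] True by simp
next
  case False
  have "enat (T - 2) < enat T" using assms by simp
  then have "enat (T - 2) < tn w" using False by (metis less_le_trans not_less)
  then show ?thesis using base_fixed[of "T - 2" w] assms odd_T by simp
qed

text \<open>An odd level path to \<open>u\<close>, extended by the mate \<open>v\<close>, is a level
  path to \<open>v\<close> with the same last vertex above \<open>T\<close>.\<close>

lemma base_T_matched_edge:
  assumes "{u, v} \<in> M" "tn u \<le> enat T"
  shows "base T u = base T v"
proof -
  obtain p where p: "level_path u p" "odd (path_length p)" using assms(2) by (rule level_path_exists)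
  then have a: "alt p" "last p = u" "enat (path_length p) = od u" by (auto simp: level_path_def lvl_def)
  obtain b where b: "last_above T p b" using last_above_exists[OF a(1) T_less] .
  have m: "{v, u} \<in> M" using assms by (simp add: insert_commute)
  have v: "tn v \<le> enat T" using tn_mate(1)[OF assms(1)] assms(2) by simp
  have "alt (p @ [v])" "path_length (p @ [v]) = Suc (path_length p)"
    using odd_path_snoc_mate[OF a(1) p(2)] a assms(1) by auto
  moreover have "ev v = enat (Suc (path_length p))" using ev_mate[OF m] a(3)[symmetric] by (simp add: one_enat_def)
  ultimately have "level_path v (p @ [v])" using p(2) by (simp add: level_path_def lvl_def)
  moreover have "last_above T (p @ [v]) b" using last_above_snoc[OF v] b by simp
  ultimately show ?thesis using base_T_eq[OF _ _ v] base_T_eq[OF p(1) b assms(2)] by simp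
qed

text \<open>An edge of tenacity exactly \<open>T\<close> is closing. By parity any other has
  tenacity at most \<open>T - 2\<close>, so its ends already share a base in the previous
  layer.\<close>

lemma base_T_unmatched_edge:
  assumes "{u, v} \<in> E" "{u, v} \<notin> M" "ev u + ev v + 1 \<le> enat T"
  shows "base T u = base T v"
proof -
  have "ev u \<noteq> \<infinity>" "ev v \<noteq> \<infinity>" using assms(3) by (cases "ev u"; cases "ev v"; simp)+
  obtain p where p: "level_path u p" "even (path_length p)" "ev u = enat (path_length p)"
    using \<open>ev u \<noteq> \<infinity>\<close> by (rule ev_attained)
  obtain q where q: "level_path v q" "even (path_length q)" "ev v = enat (path_length q)"
    using \<open>ev v \<noteq> \<infinity>\<close> by (rule ev_attained)
  have le: "path_length p + path_length q + 1 \<le> T" using assms(3) p q by (simp add: one_enat_def)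
  show ?thesis
  proof (cases "path_length p + path_length q + 1 = T")
    case True
    then have cl: "closing u v p q" using assms p q by (simp add: closing_def)
    have "alt p" "alt q" using p q by (auto simp: level_path_def)
    then obtain b c where bc: "last_above T p b" "last_above T q c"
      using last_above_exists T_less by metis
    then show ?thesis using base_T_level_path p q closing_base[OF cl bc] by metis
  next
    case False
    then have "path_length p + path_length q + 1 < T" using le by simp
    then have le: "path_length p + path_length q + 1 \<le> T - 2" and T3: "3 \<le> T" using odd_T p q by presburger+
    have "\<beta> (T - 2) u = \<beta> (T - 2) v"
      using assms(1,2) le T3 odd_T p q by (intro unmatched_edge_base) (auto simp: one_enat_def)
    then show ?thesis using base_T_base[OF T3] by metis
  qed
qed

end

section \<open>Induction over the stages\<close>

context matched_graph begin

text \<open>What each stage proves about \<open>base\<close> at its own bound is what all later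
  stages assume of it.\<close>

lemma stage_base:
  assumes "odd \<tau>" "enat \<tau> < min_augmenting_length V E M"
  shows "stage V E M \<tau> base"
  using assms
proof (induction \<tau> rule: less_induct)
  case (less \<tau>)
  have IH: "stage V E M \<sigma> base" if "odd \<sigma>" "\<sigma> < \<tau>" for \<sigma>
  proof -
    have "enat \<sigma> < enat \<tau>" using that by simp
    then have "enat \<sigma> < min_augmenting_length V E M" using less.prems(2) by (rule less_trans)
    then show ?thesis using less.IH that by blast
  qed
  show ?case
  proof unfold_locales
    show "odd \<tau>" "enat \<tau> < min_augmenting_length V E M" using less.prems by auto
    show "base \<sigma> u = base \<sigma> v" if "odd \<sigma>" "\<sigma> < \<tau>" "{u, v} \<in> E" "{u, v} \<notin> M" "ev u + ev v + 1 \<le> enat \<sigma>" for \<sigma> u v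
      using stage.base_T_unmatched_edge[OF IH[OF that(1,2)] that(3-5)] .
    show "base \<sigma> u = base \<sigma> v" if "odd \<sigma>" "\<sigma> < \<tau>" "{u, v} \<in> M" "tn u \<le> enat \<sigma>" for \<sigma> u v
      using stage.base_T_matched_edge[OF IH[OF that(1,2)] that(3-4)] .
    show "base \<sigma> u = u" if "odd \<sigma>" "\<sigma> < \<tau>" "enat \<sigma> < tn u" for \<sigma> u
      using that by (intro base_above)
    show "enat \<sigma> < tn (base \<sigma> u)" if "odd \<sigma>" "\<sigma> < \<tau>" for \<sigma> u
      using stage.base_T_tn[OF IH[OF that]] .
  qed
qed

end

theorem theorem2:
  fixes V :: "'a set" and E M :: "'a set set" and v :: 'a
  assumes "finite_graph V E"
    and "matching E M"
    and "unmatched V M \<noteq> {}"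
    and "v \<in> V"
    and "tenacity V E M v < min_augmenting_length V E M"
  shows "is_singleton {base_wrt V E M p v | p. evenlevel_path V E M v p \<or> oddlevel_path V E M v p}"
proof -
  interpret matched_graph V E M using assms by unfold_locales
  obtain k where k: "tn v = enat k" using assms(5) by (cases "tn v") auto
  then have "tn v \<le> enat k" by simp
  then obtain a b where "even a" "odd b" "tn v = enat (a + b)" by (rule tn_finiteD)
  then have \<tau>: "odd k" "enat k < min_augmenting_length V E M" using k assms(5) by auto
  interpret stage V E M k base using \<tau> by (rule stage_base)
  have eq: "base_wrt V E M p v = base k v" if "level_path v p" for p
  proof -
    have "alt p" using that by (simp add: level_path_def)
    then obtain b where b: "last_above k p b" using last_above_exists T_less by blast
    then show ?thesis using base_wrt_eq[OF b k] base_T_level_path[OF that b] by simp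
  qed
  \<comment> \<open>A singleton must be non-empty, so at least one level path is needed; finite
    tenacity provides it.\<close>
  obtain p where "level_path v p" using \<open>tn v \<le> enat k\<close> by (rule level_path_exists)
  then have "{base_wrt V E M p v | p. level_path v p} = {base k v}" using eq by force
  then show ?thesis by (simp add: level_path_iff)
qed

end
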